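(* Let $m\in\mathbb{Z}^+$. The map $W^{(m)}:\mathbb{R}^2\to\mathbb{R}^3$, a solution of $\Delta u-2u_{x_1}\wedge u_{x_2}=0$ in $\mathbb{R}^2$, is non-degenerate in the following sense: every bounded solution $\phi:\mathbb{R}^2\to\mathbb{R}^3$ of the linearized equation $$\Delta\phi=2\left(W^{(m)}_{x_1}\wedge\phi_{x_2}+\phi_{x_1}\wedge W^{(m)}_{x_2}\right)\quad\text{in }\mathbb{R}^2$$ (in polar coordinates $\Delta\phi=\frac2r(W^{(m)}_r\wedge\phi_\theta+\phi_r\wedge W^{(m)}_\theta)$) is a linear combination of the following $4m+5$ functions: $$\frac{r^{2m}-1}{r^{2m}+1}W^{(m)},\quad \frac{r^m}{1+r^{2m}}\cos(m\theta)W^{(m)},\quad \frac{r^m}{1+r^{2m}}\sin(m\theta)W^{(m)},$$ $$\frac{r^{m-k}}{1+r^{2m}}\left(\cos(k\theta)E_1^{(m)}+\sin(k\theta)E_2^{(m)}\right),\quad \frac{r^{m-k}}{1+r^{2m}}\left(\sin(k\theta)E_1^{(m)}-\cos(k\theta)E_2^{(m)}\right),\quad k=0,1,\dots,m,$$ $$\frac{r^{m+l}}{1+r^{2m}}\left(\cos(l\theta)E_1^{(m)}-\sin(l\theta)E_2^{(m)}\right),\quad \frac{r^{m+l}}{1+r^{2m}}\left(\sin(l\theta)E_1^{(m)}+\cos(l\theta)E_2^{(m)}\right),\quad l=1,\dots,m.$$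
   Context: $\wedge$ denotes the cross product in $\mathbb{R}^3$, subscripts denote partial derivatives, and $x=(r\cos\theta,r\sin\theta)\in\mathbb{R}^2$ are polar coordinates. The maps are $$W^{(m)}(r,\theta)=\begin{bmatrix}\frac{2r^m\cos(m\theta)}{r^{2m}+1}\\ \frac{2r^m\sin(m\theta)}{r^{2m}+1}\\ \frac{r^{2m}-1}{r^{2m}+1}\end{bmatrix},\quad E_1^{(m)}(r,\theta)=\begin{bmatrix}\frac{r^{2m}-1}{r^{2m}+1}\cos(m\theta)\\ \frac{r^{2m}-1}{r^{2m}+1}\sin(m\theta)\\ \frac{-2r^m}{r^{2m}+1}\end{bmatrix},\quad E_2^{(m)}(r,\theta)=\begin{bmatrix}-\sin(m\theta)\\ \cos(m\theta)\\ 0\end{bmatrix}.$$ *)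

theory Defs
  imports "HOL-Analysis.Analysis"
begin

definition partial :: "'n::finite \<Rightarrow> (real^'n \<Rightarrow> 'b::real_normed_vector) \<Rightarrow> real^'n \<Rightarrow> 'b" where
  "partial i u x = vector_derivative (\<lambda>t. u (x + t *\<^sub>R axis i 1)) (at 0)"

definition laplacian :: "(real^'n::finite \<Rightarrow> 'b::real_normed_vector) \<Rightarrow> real^'n \<Rightarrow> 'b" where
  "laplacian u x = (\<Sum>i\<in>UNIV. partial i (partial i u) x)"

text \<open>Differentiability is required explicitly because \<^const>\<open>partial\<close> returns an arbitrary value
  where the derivative does not exist.\<close>

definition C2 :: "(real^'n::finite \<Rightarrow> 'b::real_normed_vector) \<Rightarrow> bool" where
  "C2 u \<longleftrightarrow> u differentiable_on UNIV
     \<and> (\<forall>i. partial i u differentiable_on UNIV)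
     \<and> (\<forall>i j. continuous_on UNIV (partial j (partial i u)))"

text \<open>The wedge product on three-dimensional space is the library's \<^const>\<open>cross3\<close>.\<close>

definition H_system_solution :: "(real^2 \<Rightarrow> real^3) \<Rightarrow> bool" where
  "H_system_solution u \<longleftrightarrow> C2 u \<and>
     (\<forall>x. laplacian u x - 2 *\<^sub>R cross3 (partial 1 u x) (partial 2 u x) = 0)"

definition linearized_solution :: "(real^2 \<Rightarrow> real^3) \<Rightarrow> (real^2 \<Rightarrow> real^3) \<Rightarrow> bool" where
  "linearized_solution w \<phi> \<longleftrightarrow> C2 \<phi> \<and>
     (\<forall>x. laplacian \<phi> x =
        2 *\<^sub>R (cross3 (partial 1 w x) (partial 2 \<phi> x) + cross3 (partial 1 \<phi> x) (partial 2 w x)))"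

definition polar :: "real \<Rightarrow> real \<Rightarrow> real^2" where
  "polar r \<theta> = vector [r * cos \<theta>, r * sin \<theta>]"

definition dr :: "(real^2 \<Rightarrow> 'b::real_normed_vector) \<Rightarrow> real \<Rightarrow> real \<Rightarrow> 'b" where
  "dr u r \<theta> = vector_derivative (\<lambda>s. u (polar s \<theta>)) (at r)"

definition dtheta :: "(real^2 \<Rightarrow> 'b::real_normed_vector) \<Rightarrow> real \<Rightarrow> real \<Rightarrow> 'b" where
  "dtheta u r \<theta> = vector_derivative (\<lambda>s. u (polar r s)) (at \<theta>)"

definition W_polar :: "nat \<Rightarrow> real \<Rightarrow> real \<Rightarrow> real^3" where
  "W_polar m r \<theta> = vector
     [2 * r ^ m * cos (real m * \<theta>) / (r ^ (2 * m) + 1),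
      2 * r ^ m * sin (real m * \<theta>) / (r ^ (2 * m) + 1),
      (r ^ (2 * m) - 1) / (r ^ (2 * m) + 1)]"

definition E1 :: "nat \<Rightarrow> real \<Rightarrow> real \<Rightarrow> real^3" where
  "E1 m r \<theta> = vector
     [(r ^ (2 * m) - 1) / (r ^ (2 * m) + 1) * cos (real m * \<theta>),
      (r ^ (2 * m) - 1) / (r ^ (2 * m) + 1) * sin (real m * \<theta>),
      - 2 * r ^ m / (r ^ (2 * m) + 1)]"

definition E2 :: "nat \<Rightarrow> real \<Rightarrow> real \<Rightarrow> real^3" where
  "E2 m r \<theta> = vector [- sin (real m * \<theta>), cos (real m * \<theta>), 0]"

text \<open>\<open>W m\<close> is \<open>W_polar m\<close> as a map on the plane. Fixing the angle by \<^const>\<open>Arg\<close> is immaterial: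
  by \<open>W_at_polar\<close> below every pair of polar coordinates of a point gives the same value.\<close>

definition W :: "nat \<Rightarrow> real^2 \<Rightarrow> real^3" where
  "W m x = W_polar m (norm x) (Arg (Complex (x $ 1) (x $ 2)))"

lemma W_at_polar:
  assumes "m \<ge> 1" and "r \<ge> 0"
  shows "W m (polar r \<theta>) = W_polar m r \<theta>"
proof (cases "r = 0")
  case True
  then show ?thesis using assms
    by (simp add: W_def W_polar_def polar_def norm_vec_def L2_set_def sum_2 power_0_left)
next
  case False
  with assms have r: "r > 0" by simp
  define z where "z = Complex (r * cos \<theta>) (r * sin \<theta>)"
  have z: "z = of_real r * cis \<theta>" by (simp add: z_def complex_eq_iff)
  have nz: "norm (polar r \<theta>) = r"
    using r by (simp add: polar_def norm_vec_def L2_set_def sum_2 power_mult_distrib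
        flip: distrib_left)
  have "cis (Arg z) = cis \<theta>"
    using r by (simp add: z cis_Arg sgn_mult sgn_of_real)
  then have "cis (real m * Arg z) = cis (real m * \<theta>)"
    by (simp flip: Complex.DeMoivre)
  then have "cos (real m * Arg z) = cos (real m * \<theta>)" "sin (real m * Arg z) = sin (real m * \<theta>)"
    by (simp_all add: complex_eq_iff)
  then show ?thesis
    unfolding W_def nz by (simp add: W_polar_def polar_def flip: z_def)
qed

end

theory Submission
  imports Defs
begin

text \<open>Both the equation and its linearization are conformally invariant, so away from the origin they
  may be read on a cylinder with coordinates \<open>t = ln r\<close> and \<open>\<theta>\<close>. There
  \<open>W = (S cos m\<theta>, S sin m\<theta>, T)\<close> with \<open>S = 1 / cosh (m t)\<close> and \<open>T = tanh (m t)\<close>, and a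
  solution \<open>\<phi>\<close> of the linearized equation satisfies
  \<open>\<phi>\<^sub>t\<^sub>t + \<phi>\<^sub>\<theta>\<^sub>\<theta> = 2 (W\<^sub>t \<times> \<phi>\<^sub>\<theta> + \<phi>\<^sub>t \<times> W\<^sub>\<theta>)\<close>
  (\<open>cyl_equation\<close>). The map \<open>W\<close> is a conformal harmonic map into the unit sphere, with
  \<open>W \<times> W\<^sub>t = - W\<^sub>\<theta>\<close> and \<open>W \<times> W\<^sub>\<theta> = W\<^sub>t\<close>. For this reason the equation splits along \<open>W\<close> and its
  orthogonal complement.

  The normal part \<open>g = \<phi> \<bullet> W\<close> satisfies \<open>\<Delta>g = - 2 m\<^sup>2 S\<^sup>2 g\<close> (\<open>normal_equation\<close>). Its \<open>k\<close>-th Fourier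
  coefficient in \<open>\<theta>\<close> solves \<open>y'' = (k\<^sup>2 - 2 m\<^sup>2 S\<^sup>2) y\<close>. The function \<open>exp (\<bar>k\<bar> t) (\<bar>k\<bar> - m T)\<close> is a
  solution, and the Wronskian with it vanishes because \<open>\<phi>\<close> is continuously differentiable at the origin. So
  \<open>y\<close> is a multiple of it, and boundedness at infinity leaves \<open>k = 0\<close> and \<open>k = \<plusminus>m\<close>
  (\<open>normal_mode_solution\<close>). This accounts for the three multiples of \<open>W\<close>.

  The tangential part is encoded in the complex function
  \<open>f = \<phi> \<bullet> N\<^sub>1 + \<i> \<phi> \<bullet> N\<^sub>2\<close> with \<open>N\<^sub>1 = - cosh (m t) E\<^sub>1\<close> and \<open>N\<^sub>2 = cosh (m t) E\<^sub>2\<close>, the vectors dual to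
  \<open>W\<^sub>t\<close> and \<open>W\<^sub>\<theta>\<close> up to a constant. It satisfies
  \<open>\<Delta>f = 2 m T (f\<^sub>t + \<i> f\<^sub>\<theta>)\<close> (\<open>tangential_equation\<close>), an equation that factors through the
  Cauchy-Riemann operator: in the \<open>k\<close>-th Fourier coefficient \<open>y\<close>, the expression \<open>y' - k y\<close> solves a
  first-order equation and equals \<open>c exp (- k t) cosh\<^sup>2 (m t)\<close>. If \<open>c \<noteq> 0\<close>, integrating once more makes
  \<open>y\<close> outgrow the bound \<open>\<bar>f\<bar> \<le> const cosh (m t)\<close> at one end of the cylinder. Hence \<open>c = 0\<close>,
  \<open>y\<close> is a multiple of \<open>exp (k t)\<close>, and the same bound gives \<open>\<bar>k\<bar> \<le> m\<close>
  (\<open>tangential_mode_solution\<close>). These are \<open>2 m + 1\<close> complex coefficients, that is, the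
  \<open>4 m + 2\<close> tangential functions.

  A continuous periodic function with finitely many nonzero Fourier coefficients is the
  corresponding finite sum (\<open>finite_fourier_expansion\<close>), so both parts are recovered from their
  coefficients for \<open>r > 0\<close>, and by continuity at the origin.\<close>

section \<open>Partial derivatives in the plane\<close>

text \<open>The total derivative in terms of prescribed partial derivative functions. In contrast to
  \<^const>\<open>partial\<close>, which is a choice of limit, this relation can be derived by the usual rules.\<close>

definition has_partials ::
  "(real^2 \<Rightarrow> 'b::real_normed_vector) \<Rightarrow> (real^2 \<Rightarrow> 'b) \<Rightarrow> (real^2 \<Rightarrow> 'b) \<Rightarrow> bool" where
  "has_partials u u1 u2 \<longleftrightarrow>
     (\<forall>x. (u has_derivative (\<lambda>h. (h $ 1) *\<^sub>R u1 x + (h $ 2) *\<^sub>R u2 x)) (at x))"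

lemma has_partials_chain:
  assumes "has_partials u u1 u2" and c: "(c has_vector_derivative c') (at s)"
  shows "((\<lambda>s. u (c s)) has_vector_derivative (c' $ 1) *\<^sub>R u1 (c s) + (c' $ 2) *\<^sub>R u2 (c s)) (at s)"
proof -
  have "((\<lambda>s. u (c s)) has_derivative (\<lambda>h. ((h *\<^sub>R c') $ 1) *\<^sub>R u1 (c s) + ((h *\<^sub>R c') $ 2) *\<^sub>R u2 (c s))) (at s)"
    using has_derivative_compose[OF c[unfolded has_vector_derivative_def]] assms(1)
    unfolding has_partials_def by blast
  then show ?thesis by (simp add: has_vector_derivative_def algebra_simps)
qed

lemma has_partials_partial:
  assumes "has_partials u u1 u2"
  shows "partial 1 u = u1" "partial 2 u = u2"
proof -
  have "((\<lambda>t. x + t *\<^sub>R axis i (1::real)) has_vector_derivative axis i 1) (at 0)" for x :: "real^2" and i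
    by (auto intro!: derivative_eq_intros)
  from has_partials_chain[OF assms this]
  have "partial i u x = (axis i 1 $ 1) *\<^sub>R u1 x + (axis i 1 $ 2) *\<^sub>R u2 x" for x i
    unfolding partial_def by (auto intro!: vector_derivative_at)
  then show "partial 1 u = u1" "partial 2 u = u2" by (auto simp: axis_def)
qed

lemma has_partials_of_differentiable:
  fixes u :: "real^2 \<Rightarrow> 'b::real_normed_vector"
  assumes "u differentiable_on UNIV"
  shows "has_partials u (partial 1 u) (partial 2 u)"
proof -
  have *: "has_partials u (\<lambda>x. frechet_derivative u (at x) (axis 1 1)) (\<lambda>x. frechet_derivative u (at x) (axis 2 1))"
    unfolding has_partials_def
  proof
    fix x
    have d: "(u has_derivative frechet_derivative u (at x)) (at x)"
      using assms by (simp add: differentiable_on_def frechet_derivative_works)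
    then have lin: "linear (frechet_derivative u (at x))" by (rule has_derivative_linear)
    have "frechet_derivative u (at x) h = (h $ 1) *\<^sub>R frechet_derivative u (at x) (axis 1 1) + (h $ 2) *\<^sub>R frechet_derivative u (at x) (axis 2 1)" for h
    proof -
      have "h = (h $ 1) *\<^sub>R axis 1 1 + (h $ 2) *\<^sub>R axis 2 1"
        by (simp add: vec_eq_iff forall_2 axis_def)
      then have "frechet_derivative u (at x) h = frechet_derivative u (at x) ((h $ 1) *\<^sub>R axis 1 1 + (h $ 2) *\<^sub>R axis 2 1)"
        by simp
      then show ?thesis by (simp only: linear_add[OF lin] linear_scale[OF lin])
    qed
    then have eq: "frechet_derivative u (at x) = (\<lambda>h. (h $ 1) *\<^sub>R frechet_derivative u (at x) (axis 1 1) + (h $ 2) *\<^sub>R frechet_derivative u (at x) (axis 2 1))"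
      by (rule ext)
    show "(u has_derivative (\<lambda>h. (h $ 1) *\<^sub>R frechet_derivative u (at x) (axis 1 1) + (h $ 2) *\<^sub>R frechet_derivative u (at x) (axis 2 1))) (at x)"
      by (subst eq[symmetric]) (rule d)
  qed
  with has_partials_partial[OF *] show ?thesis by simp
qed

lemma has_partials_differentiable: "has_partials u u1 u2 \<Longrightarrow> u differentiable_on UNIV"
  unfolding has_partials_def differentiable_on_def differentiable_def by blast

lemma has_partials_continuous: "has_partials u u1 u2 \<Longrightarrow> continuous_on A u"
  by (rule continuous_on_subset[OF differentiable_imp_continuous_on[OF has_partials_differentiable] subset_UNIV])

lemma C2I:
  assumes "has_partials u u1 u2" "has_partials u1 u11 u12" "has_partials u2 u21 u22"
    and "continuous_on UNIV u11" "continuous_on UNIV u12" "continuous_on UNIV u21" "continuous_on UNIV u22"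
  shows "C2 u"
  using assms(4-7) assms(1-3)[THEN has_partials_differentiable]
  unfolding C2_def forall_2 has_partials_partial[OF assms(1)] has_partials_partial[OF assms(2)]
    has_partials_partial[OF assms(3)]
  by (intro conjI)

lemma C2D:
  assumes "C2 (u :: real^2 \<Rightarrow> 'b::real_normed_vector)"
  shows "has_partials u (partial 1 u) (partial 2 u)"
    "has_partials (partial i u) (partial 1 (partial i u)) (partial 2 (partial i u))"
    "continuous_on A (partial j (partial i u))"
    "continuous_on A (partial i u)"
proof -
  have d: "u differentiable_on UNIV" "partial i u differentiable_on UNIV"
    "continuous_on UNIV (partial j (partial i u))"
    using assms by (auto simp: C2_def)
  show "has_partials u (partial 1 u) (partial 2 u)"
    "has_partials (partial i u) (partial 1 (partial i u)) (partial 2 (partial i u))"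
    by (rule has_partials_of_differentiable[OF d(1)], rule has_partials_of_differentiable[OF d(2)])
  show "continuous_on A (partial j (partial i u))" "continuous_on A (partial i u)"
    by (rule continuous_on_subset[OF d(3) subset_UNIV],
        rule continuous_on_subset[OF differentiable_imp_continuous_on[OF d(2)] subset_UNIV])
qed

lemma laplacian_2: "laplacian u x = partial 1 (partial 1 u) x + partial 2 (partial 2 u) (x :: real^2)"
  by (simp add: laplacian_def sum_2)

lemma has_partials_eq_rhs:
  "has_partials u u1 u2 \<Longrightarrow> u1 = v1 \<Longrightarrow> u2 = v2 \<Longrightarrow> has_partials u v1 v2"
  by simp

lemma has_partials_const: "has_partials (\<lambda>x. c) (\<lambda>x. 0) (\<lambda>x. 0)"
  by (simp add: has_partials_def)

lemma has_partials_add: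
  "has_partials u u1 u2 \<Longrightarrow> has_partials v v1 v2 \<Longrightarrow>
   has_partials (\<lambda>x. u x + v x) (\<lambda>x. u1 x + v1 x) (\<lambda>x. u2 x + v2 x)"
  unfolding has_partials_def by (auto intro!: derivative_eq_intros simp: algebra_simps)

lemma has_partials_scaleR:
  "has_partials u u1 u2 \<Longrightarrow> has_partials (\<lambda>x. u x *\<^sub>R v) (\<lambda>x. u1 x *\<^sub>R v) (\<lambda>x. u2 x *\<^sub>R v)"
  unfolding has_partials_def by (auto intro!: derivative_eq_intros simp: algebra_simps)

lemma has_partials_mult:
  fixes u v :: "real^2 \<Rightarrow> real"
  shows "has_partials u u1 u2 \<Longrightarrow> has_partials v v1 v2 \<Longrightarrow>
   has_partials (\<lambda>x. u x * v x) (\<lambda>x. u1 x * v x + u x * v1 x) (\<lambda>x. u2 x * v x + u x * v2 x)"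
  unfolding has_partials_def by (auto intro!: derivative_eq_intros simp: algebra_simps)

lemma has_partials_cmult:
  fixes u :: "real^2 \<Rightarrow> real"
  shows "has_partials u u1 u2 \<Longrightarrow> has_partials (\<lambda>x. c * u x) (\<lambda>x. c * u1 x) (\<lambda>x. c * u2 x)"
  by (rule has_partials_eq_rhs[OF has_partials_mult[OF has_partials_const]]) auto

lemma has_partials_inverse:
  fixes u :: "real^2 \<Rightarrow> real"
  assumes "has_partials u u1 u2" "\<And>x. u x \<noteq> 0"
  shows "has_partials (\<lambda>x. inverse (u x)) (\<lambda>x. - (u1 x * (inverse (u x))\<^sup>2)) (\<lambda>x. - (u2 x * (inverse (u x))\<^sup>2))"
  using assms unfolding has_partials_def
  by (auto intro!: derivative_eq_intros simp: algebra_simps power2_eq_square)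

lemmas has_partials_intros = has_partials_const has_partials_cmult has_partials_add has_partials_mult

lemma vector_3_axis: "(vector [a, b, c] :: real^3) = a *\<^sub>R axis 1 1 + b *\<^sub>R axis 2 1 + c *\<^sub>R axis 3 1"
  by (simp add: vec_eq_iff forall_3 axis_def)

lemma has_partials_vector_3:
  assumes "has_partials f f1 f2" "has_partials g g1 g2" "has_partials h h1 h2"
  shows "has_partials (\<lambda>x. vector [f x, g x, h x] :: real^3)
     (\<lambda>x. vector [f1 x, g1 x, h1 x]) (\<lambda>x. vector [f2 x, g2 x, h2 x])"
  unfolding vector_3_axis by (intro has_partials_add has_partials_scaleR assms)

lemma continuous_on_vector_3:
  "continuous_on A f \<Longrightarrow> continuous_on A g \<Longrightarrow> continuous_on A h \<Longrightarrow>
   continuous_on A (\<lambda>x. vector [f x, g x, h x] :: real^3)"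
  unfolding vector_3_axis by (intro continuous_intros)

text \<open>\<open>W\<close> is inverse stereographic projection composed with \<open>z ^ m = P + \<i> Q\<close>, and the equation is
  invariant under holomorphic changes of variable: all that matters is that \<open>P\<close> and \<open>Q\<close> satisfy the
  Cauchy-Riemann equations (with common derivatives \<open>a\<close>, \<open>b\<close>, and second derivatives \<open>c\<close>, \<open>d\<close>).
  In the reciprocal \<open>K\<close> of \<open>1 + P\<^sup>2 + Q\<^sup>2\<close> all derivatives are polynomial, and the equation
  reduces to a polynomial identity modulo \<open>K (1 + P\<^sup>2 + Q\<^sup>2) = 1\<close>.\<close>

lemma H_system_stereographic:
  fixes P Q a b c d :: "real^2 \<Rightarrow> real"
  assumes P: "has_partials P a (\<lambda>x. - b x)" and Q: "has_partials Q b a"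
    and a: "has_partials a c (\<lambda>x. - d x)" and b: "has_partials b d c"
    and cd: "continuous_on UNIV c" "continuous_on UNIV d"
  defines "K \<equiv> \<lambda>x. inverse (1 + (P x * P x + Q x * Q x))"
  shows "H_system_solution (\<lambda>x. vector [2 * (P x * K x), 2 * (Q x * K x), 1 + (- 2) * K x])"
proof -
  have pos: "1 + (P x * P x + Q x * Q x) \<noteq> 0" for x
    using sum_squares_ge_zero[of "P x" "Q x"] by linarith
  have Kd: "K x * (1 + (P x * P x + Q x * Q x)) = 1" for x using pos[of x] by (simp add: K_def)
  define L where "L = (\<lambda>x. P x * a x + Q x * b x)"
  define M where "M = (\<lambda>x. Q x * a x + (- 1) * (P x * b x))"
  define F where "F = (\<lambda>x. a x * a x + b x * b x + (P x * c x + Q x * d x))"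
  define G where "G = (\<lambda>x. Q x * c x + (- 1) * (P x * d x))"
  define H where "H = (\<lambda>x. a x * a x + b x * b x + (- 1) * (P x * c x + Q x * d x))"
  have L: "has_partials L F G" unfolding L_def F_def G_def
    by (rule has_partials_eq_rhs, (rule has_partials_intros P Q a b)+) (auto simp: algebra_simps)
  have M: "has_partials M G H" unfolding M_def G_def H_def
    by (rule has_partials_eq_rhs, (rule has_partials_intros P Q a b)+) (auto simp: algebra_simps)
  define K1 where "K1 = (\<lambda>x. (- 2) * (L x * (K x * K x)))"
  define K2 where "K2 = (\<lambda>x. (- 2) * (M x * (K x * K x)))"
  have K: "has_partials K K1 K2" unfolding K_def
    by (rule has_partials_eq_rhs, rule has_partials_inverse, (rule has_partials_intros P Q)+)
       (auto simp: K1_def K2_def L_def M_def K_def pos algebra_simps power2_eq_square)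
  define K11 where "K11 = (\<lambda>x. (- 2) * (F x * (K x * K x) + L x * (K1 x * K x + K x * K1 x)))"
  define K12 where "K12 = (\<lambda>x. (- 2) * (G x * (K x * K x) + L x * (K2 x * K x + K x * K2 x)))"
  define K21 where "K21 = (\<lambda>x. (- 2) * (G x * (K x * K x) + M x * (K1 x * K x + K x * K1 x)))"
  define K22 where "K22 = (\<lambda>x. (- 2) * (H x * (K x * K x) + M x * (K2 x * K x + K x * K2 x)))"
  have "has_partials (\<lambda>x. (- 2) * (L x * (K x * K x))) K11 K12"
    unfolding K11_def K12_def by (intro has_partials_cmult has_partials_mult K L)
  then have K1: "has_partials K1 K11 K12" by (simp only: K1_def)
  have "has_partials (\<lambda>x. (- 2) * (M x * (K x * K x))) K21 K22"
    unfolding K21_def K22_def by (intro has_partials_cmult has_partials_mult K M)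
  then have K2: "has_partials K2 K21 K22" by (simp only: K2_def)
  let ?u = "\<lambda>x. vector [2 * (P x * K x), 2 * (Q x * K x), 1 + (- 2) * K x] :: real^3"
  let ?u1 = "\<lambda>x. vector [2 * (a x * K x + P x * K1 x), 2 * (b x * K x + Q x * K1 x), 0 + (- 2) * K1 x] :: real^3"
  let ?u2 = "\<lambda>x. vector [2 * (- b x * K x + P x * K2 x), 2 * (a x * K x + Q x * K2 x), 0 + (- 2) * K2 x] :: real^3"
  let ?u11 = "\<lambda>x. vector [2 * (c x * K x + a x * K1 x + (a x * K1 x + P x * K11 x)),
      2 * (d x * K x + b x * K1 x + (b x * K1 x + Q x * K11 x)), 0 + (- 2) * K11 x] :: real^3"
  let ?u12 = "\<lambda>x. vector [2 * (- d x * K x + a x * K2 x + (- b x * K1 x + P x * K12 x)),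
      2 * (c x * K x + b x * K2 x + (a x * K1 x + Q x * K12 x)), 0 + (- 2) * K12 x] :: real^3"
  let ?u21 = "\<lambda>x. vector [2 * (- d x * K x + - b x * K1 x + (a x * K2 x + P x * K21 x)),
      2 * (c x * K x + a x * K1 x + (b x * K2 x + Q x * K21 x)), 0 + (- 2) * K21 x] :: real^3"
  let ?u22 = "\<lambda>x. vector [2 * (- c x * K x + - b x * K2 x + (- b x * K2 x + P x * K22 x)),
      2 * (- d x * K x + a x * K2 x + (a x * K2 x + Q x * K22 x)), 0 + (- 2) * K22 x] :: real^3"
  have mb: "has_partials (\<lambda>x. - b x) (\<lambda>x. - d x) (\<lambda>x. - c x)"
    using has_partials_cmult[OF b, of "- 1"] by simp
  have u: "has_partials ?u ?u1 ?u2"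
    by (intro has_partials_vector_3 has_partials_intros P Q K)
  have u1: "has_partials ?u1 ?u11 ?u12"
    by (intro has_partials_vector_3 has_partials_intros P Q K a b K1)
  have u2: "has_partials ?u2 ?u21 ?u22"
    by (intro has_partials_vector_3 has_partials_intros P Q K a mb K2)
  note cont = P[THEN has_partials_continuous] Q[THEN has_partials_continuous]
    a[THEN has_partials_continuous] b[THEN has_partials_continuous] K[THEN has_partials_continuous]
    K1[THEN has_partials_continuous] K2[THEN has_partials_continuous] cd
  note cont2 = cont L[THEN has_partials_continuous] M[THEN has_partials_continuous]
  have FGH: "continuous_on UNIV F" "continuous_on UNIV G" "continuous_on UNIV H"
    unfolding F_def G_def H_def by (intro continuous_intros cont)+
  have KK: "continuous_on UNIV K11" "continuous_on UNIV K12" "continuous_on UNIV K21" "continuous_on UNIV K22"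
    unfolding K11_def K12_def K21_def K22_def by (intro continuous_intros cont2 FGH)+
  have "C2 ?u"
    by (rule C2I[OF u u1 u2]; intro continuous_on_vector_3 continuous_intros cont KK)
  moreover have "laplacian ?u x - 2 *\<^sub>R cross3 (partial 1 ?u x) (partial 2 ?u x) = 0" for x
  proof -
    have "laplacian ?u x = ?u11 x + ?u22 x"
      unfolding laplacian_2 has_partials_partial[OF u] has_partials_partial[OF u1] has_partials_partial[OF u2] ..
    moreover have "?u11 x + ?u22 x - 2 *\<^sub>R cross3 (?u1 x) (?u2 x) = 0"
    proof -
      \<comment> \<open>The conformal factor. The terms with \<open>c\<close> and \<open>d\<close> cancel in the Laplacian because \<open>P\<close> and \<open>Q\<close> are harmonic.\<close>
      define E where "E = a x * a x + b x * b x"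
      have K\<rho>: "K x * (P x * P x + Q x * Q x) = 1 - K x" using Kd[of x] by (simp add: algebra_simps)
      have s: "a x * K1 x - b x * K2 x = - 2 * (K x * K x) * P x * E"
        "b x * K1 x + a x * K2 x = - 2 * (K x * K x) * Q x * E"
        by (simp_all add: K1_def K2_def L_def M_def E_def algebra_simps)
      have "K11 x + K22 x = 8 * (K x * K x) * E * (K x * (P x * P x + Q x * Q x)) - 4 * (K x * K x) * E"
        by (simp add: K11_def K22_def K1_def K2_def L_def M_def F_def H_def E_def algebra_simps)
      then have K22: "K22 x = 4 * (K x * K x) * E * (1 - 2 * K x) - K11 x"
        unfolding K\<rho> by (simp add: algebra_simps)
      show ?thesis
        unfolding vec_eq_iff forall_3 cross3_def
        using s K\<rho> K22 E_def by (simp, intro conjI; algebra)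
    qed
    ultimately show ?thesis by (simp only: has_partials_partial[OF u])
  qed
  ultimately show ?thesis by (simp add: H_system_solution_def)
qed

definition plane_complex :: "real^2 \<Rightarrow> complex" where "plane_complex x = Complex (x $ 1) (x $ 2)"

lemma plane_complex_derivative: "(plane_complex has_derivative plane_complex) (at x)"
proof -
  have "bounded_linear plane_complex"
    by (rule linear_conv_bounded_linear[THEN iffD1]) (auto simp: plane_complex_def complex_eq_iff intro!: linearI)
  then show ?thesis by (rule bounded_linear_imp_has_derivative)
qed

lemma plane_complex_power_derivative: "((\<lambda>x. plane_complex x ^ n) has_derivative (\<lambda>h. of_nat n * plane_complex x ^ (n - 1) * plane_complex h)) (at x)"
  by (auto intro!: derivative_eq_intros plane_complex_derivative simp: mult_ac)

lemma has_partials_Re_power: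
  "has_partials (\<lambda>x. k * Re (plane_complex x ^ n)) (\<lambda>x. k * real n * Re (plane_complex x ^ (n - 1))) (\<lambda>x. - (k * real n * Im (plane_complex x ^ (n - 1))))"
  unfolding has_partials_def
proof
  fix x
  have "((\<lambda>x. k * Re (plane_complex x ^ n)) has_derivative (\<lambda>h. k * Re (of_nat n * plane_complex x ^ (n - 1) * plane_complex h))) (at x)"
    by (intro has_derivative_mult_right bounded_linear.has_derivative[OF bounded_linear_Re] plane_complex_power_derivative)
  then show "((\<lambda>x. k * Re (plane_complex x ^ n)) has_derivative (\<lambda>h. (h $ 1) *\<^sub>R (k * real n * Re (plane_complex x ^ (n - 1)))
     + (h $ 2) *\<^sub>R (- (k * real n * Im (plane_complex x ^ (n - 1)))))) (at x)"
    by (simp add: plane_complex_def algebra_simps)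
qed

lemma has_partials_Im_power:
  "has_partials (\<lambda>x. k * Im (plane_complex x ^ n)) (\<lambda>x. k * real n * Im (plane_complex x ^ (n - 1))) (\<lambda>x. k * real n * Re (plane_complex x ^ (n - 1)))"
  unfolding has_partials_def
proof
  fix x
  have "((\<lambda>x. k * Im (plane_complex x ^ n)) has_derivative (\<lambda>h. k * Im (of_nat n * plane_complex x ^ (n - 1) * plane_complex h))) (at x)"
    by (intro has_derivative_mult_right bounded_linear.has_derivative[OF bounded_linear_Im] plane_complex_power_derivative)
  then show "((\<lambda>x. k * Im (plane_complex x ^ n)) has_derivative (\<lambda>h. (h $ 1) *\<^sub>R (k * real n * Im (plane_complex x ^ (n - 1)))
     + (h $ 2) *\<^sub>R (k * real n * Re (plane_complex x ^ (n - 1))))) (at x)"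
    by (simp add: plane_complex_def algebra_simps)
qed

lemma polar_surj: "\<exists>r \<theta>. r \<ge> 0 \<and> x = polar r \<theta>"
proof (intro exI conjI)
  have "plane_complex x = of_real (cmod (plane_complex x)) * cis (Arg (plane_complex x))" using rcis_cmod_Arg[of "plane_complex x"] by (simp add: rcis_def)
  then show "x = polar (cmod (plane_complex x)) (Arg (plane_complex x))"
    by (simp add: vec_eq_iff forall_2 polar_def plane_complex_def complex_eq_iff)
qed simp

lemma plane_complex_polar: "plane_complex (polar r \<theta>) = of_real r * cis \<theta>"
  by (simp add: plane_complex_def polar_def complex_eq_iff)

lemma W_stereographic:
  assumes "m \<ge> 1"
  defines "P \<equiv> \<lambda>x. 1 * Re (plane_complex x ^ m)" and "Q \<equiv> \<lambda>x. 1 * Im (plane_complex x ^ m)"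
  defines "K \<equiv> \<lambda>x. inverse (1 + (P x * P x + Q x * Q x))"
  shows "W m = (\<lambda>x. vector [2 * (P x * K x), 2 * (Q x * K x), 1 + (- 2) * K x])"
proof
  fix x
  obtain r \<theta> where r: "r \<ge> 0" and x: "x = polar r \<theta>" using polar_surj by blast
  have "plane_complex x ^ m = of_real (r ^ m) * cis (real m * \<theta>)"
    by (simp add: x plane_complex_polar power_mult_distrib Complex.DeMoivre)
  then have P: "P x = r ^ m * cos (real m * \<theta>)" and Q: "Q x = r ^ m * sin (real m * \<theta>)"
    by (simp_all add: P_def Q_def flip: of_real_power)
  have "P x * P x + Q x * Q x = r ^ (2 * m) * ((cos (real m * \<theta>))\<^sup>2 + (sin (real m * \<theta>))\<^sup>2)"
    unfolding P Q mult_2 power_add by algebra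
  then have K: "K x = inverse (1 + r ^ (2 * m))" by (simp add: K_def)
  have "1 + r ^ (2 * m) > 0" by (simp add: add_pos_nonneg power_mult)
  then show "W m x = vector [2 * (P x * K x), 2 * (Q x * K x), 1 + (- 2) * K x]"
    unfolding P Q K unfolding x W_at_polar[OF assms(1) r] W_polar_def
    by (simp add: vec_eq_iff forall_3 divide_simps)
qed

lemma H_system_W:
  assumes "m \<ge> 1"
  shows "H_system_solution (W m)"
  unfolding W_stereographic[OF assms]
proof (rule H_system_stereographic)
  show "has_partials (\<lambda>x. 1 * Re (plane_complex x ^ m)) (\<lambda>x. 1 * real m * Re (plane_complex x ^ (m - 1))) (\<lambda>x. - (1 * real m * Im (plane_complex x ^ (m - 1))))"
    by (rule has_partials_Re_power)
  show "has_partials (\<lambda>x. 1 * Im (plane_complex x ^ m)) (\<lambda>x. 1 * real m * Im (plane_complex x ^ (m - 1))) (\<lambda>x. 1 * real m * Re (plane_complex x ^ (m - 1)))"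
    by (rule has_partials_Im_power)
  show "has_partials (\<lambda>x. 1 * real m * Re (plane_complex x ^ (m - 1))) (\<lambda>x. 1 * real m * real (m - 1) * Re (plane_complex x ^ (m - 1 - 1)))
     (\<lambda>x. - (1 * real m * real (m - 1) * Im (plane_complex x ^ (m - 1 - 1))))"
    by (rule has_partials_Re_power)
  show "has_partials (\<lambda>x. 1 * real m * Im (plane_complex x ^ (m - 1))) (\<lambda>x. 1 * real m * real (m - 1) * Im (plane_complex x ^ (m - 1 - 1)))
     (\<lambda>x. 1 * real m * real (m - 1) * Re (plane_complex x ^ (m - 1 - 1)))"
    by (rule has_partials_Im_power)
  have "continuous_on UNIV plane_complex"
    using plane_complex_derivative by (meson continuous_at_imp_continuous_on has_derivative_continuous)
  then show "continuous_on UNIV (\<lambda>x. 1 * real m * real (m - 1) * Re (plane_complex x ^ (m - 1 - 1)))"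
    "continuous_on UNIV (\<lambda>x. 1 * real m * real (m - 1) * Im (plane_complex x ^ (m - 1 - 1)))"
    by (intro continuous_intros; assumption)+
qed

lemma polar_axis: "polar r \<theta> = (r * cos \<theta>) *\<^sub>R axis 1 1 + (r * sin \<theta>) *\<^sub>R axis 2 1"
  by (simp add: polar_def vec_eq_iff forall_2 axis_def)

lemma continuous_on_polar:
  fixes g h :: "'a::t2_space \<Rightarrow> real"
  assumes "continuous_on UNIV f" and "continuous_on A g" and "continuous_on A h"
  shows "continuous_on A (\<lambda>x. f (polar (g x) (h x)))"
proof -
  have "continuous_on A (\<lambda>x. polar (g x) (h x))"
    unfolding polar_axis
    by (intro continuous_intros assms(2,3) continuous_on_cos continuous_on_sin)
  from continuous_on_compose2[OF assms(1) this] show ?thesis by simp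
qed

lemma polar_nth [simp]: "polar r \<theta> $ 1 = r * cos \<theta>" "polar r \<theta> $ 2 = r * sin \<theta>"
  by (simp_all add: polar_def)

lemma polar_radial_derivative: "((\<lambda>s. polar s \<theta>) has_vector_derivative polar 1 \<theta>) (at r)"
  unfolding polar_axis
  by (auto intro!: derivative_eq_intros simp: has_real_derivative_iff_has_vector_derivative[symmetric])

lemma polar_angular_derivative:
  "(polar r has_vector_derivative vector [- (r * sin \<theta>), r * cos \<theta>]) (at \<theta>)"
proof -
  have "((\<lambda>\<theta>. (r * cos \<theta>) *\<^sub>R axis 1 1 + (r * sin \<theta>) *\<^sub>R axis 2 1 :: real^2) has_vector_derivative
      (r * - sin \<theta>) *\<^sub>R axis 1 1 + (r * cos \<theta>) *\<^sub>R axis 2 1) (at \<theta>)"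
    by (auto intro!: derivative_eq_intros simp: has_real_derivative_iff_has_vector_derivative[symmetric] mult.commute)
  moreover have "(r * - sin \<theta>) *\<^sub>R axis 1 1 + (r * cos \<theta>) *\<^sub>R axis 2 1 = (vector [- (r * sin \<theta>), r * cos \<theta>] :: real^2)"
    by (simp add: vec_eq_iff forall_2 axis_def)
  ultimately show ?thesis by (simp add: polar_axis[abs_def])
qed

lemma dr_has_partials:
  "has_partials u u1 u2 \<Longrightarrow> dr u r \<theta> = cos \<theta> *\<^sub>R u1 (polar r \<theta>) + sin \<theta> *\<^sub>R u2 (polar r \<theta>)"
  unfolding dr_def
  by (rule vector_derivative_at) (use has_partials_chain[OF _ polar_radial_derivative] in fastforce)

lemma dtheta_has_partials:
  "has_partials u u1 u2 \<Longrightarrow>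
   dtheta u r \<theta> = (- (r * sin \<theta>)) *\<^sub>R u1 (polar r \<theta>) + (r * cos \<theta>) *\<^sub>R u2 (polar r \<theta>)"
  unfolding dtheta_def
  by (rule vector_derivative_at) (use has_partials_chain[OF _ polar_angular_derivative] in fastforce)

text \<open>Passing to the polar derivatives is a rotation by \<open>\<theta>\<close> followed by scaling the second vector by
  \<open>r\<close>; the sum of the two cross products is alternating in these two directions, so it is
  multiplied by the determinant \<open>r\<close>.\<close>

lemma cross3_polar:
  fixes u1 u2 v1 v2 :: "real^3"
  assumes "c\<^sup>2 + s\<^sup>2 = (1::real)"
  shows "cross3 (c *\<^sub>R u1 + s *\<^sub>R u2) ((- (r * s)) *\<^sub>R v1 + (r * c) *\<^sub>R v2)
       + cross3 (c *\<^sub>R v1 + s *\<^sub>R v2) ((- (r * s)) *\<^sub>R u1 + (r * c) *\<^sub>R u2)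
     = r *\<^sub>R (cross3 u1 v2 + cross3 v1 u2)"
proof -
  have "cross3 (c *\<^sub>R u1 + s *\<^sub>R u2) ((- (r * s)) *\<^sub>R v1 + (r * c) *\<^sub>R v2)
       + cross3 (c *\<^sub>R v1 + s *\<^sub>R v2) ((- (r * s)) *\<^sub>R u1 + (r * c) *\<^sub>R u2)
     = (r * (c\<^sup>2 + s\<^sup>2)) *\<^sub>R (cross3 u1 v2 + cross3 v1 u2)"
    unfolding vec_eq_iff forall_3 cross3_def by (simp add: algebra_simps power2_eq_square)
  with assms show ?thesis by simp
qed

text \<open>Off the origin the two equations agree by the chain rule. At the origin, which the polar form
  leaves out, the equation follows by continuity along a ray.\<close>

lemma polar_equation_iff:
  fixes w \<phi> :: "real^2 \<Rightarrow> real^3"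
  assumes w: "C2 w" and \<phi>: "C2 \<phi>"
  shows "linearized_solution w \<phi> \<longleftrightarrow>
      (\<forall>r>0. \<forall>\<theta>. laplacian \<phi> (polar r \<theta>) =
         (2 / r) *\<^sub>R (cross3 (dr w r \<theta>) (dtheta \<phi> r \<theta>) + cross3 (dr \<phi> r \<theta>) (dtheta w r \<theta>)))"
proof -
  define R where "R = (\<lambda>x. 2 *\<^sub>R (cross3 (partial 1 w x) (partial 2 \<phi> x) + cross3 (partial 1 \<phi> x) (partial 2 w x)))"
  have eq: "(2 / r) *\<^sub>R (cross3 (dr w r \<theta>) (dtheta \<phi> r \<theta>) + cross3 (dr \<phi> r \<theta>) (dtheta w r \<theta>)) = R (polar r \<theta>)"
    if "r > 0" for r \<theta>
    unfolding R_def dr_has_partials[OF C2D(1)[OF w]] dr_has_partials[OF C2D(1)[OF \<phi>]]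
      dtheta_has_partials[OF C2D(1)[OF w]] dtheta_has_partials[OF C2D(1)[OF \<phi>]]
    using that by (subst cross3_polar) auto
  have "(\<forall>x. laplacian \<phi> x = R x) \<longleftrightarrow> (\<forall>r>0. \<forall>\<theta>. laplacian \<phi> (polar r \<theta>) = R (polar r \<theta>))"
  proof (safe)
    assume *: "\<forall>r>0. \<forall>\<theta>. laplacian \<phi> (polar r \<theta>) = R (polar r \<theta>)"
    fix x
    have c: "continuous_on UNIV (\<lambda>r. laplacian \<phi> (polar r \<theta>))" "continuous_on UNIV (\<lambda>r. R (polar r \<theta>))" for \<theta>
      unfolding R_def laplacian_2
      by (intro continuous_intros continuous_on_cross C2D(3)[OF \<phi>, THEN continuous_on_polar]
          C2D(4)[OF \<phi>, THEN continuous_on_polar] C2D(4)[OF w, THEN continuous_on_polar])+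
    obtain r \<theta> where r: "r \<ge> 0" "x = polar r \<theta>" using polar_surj by blast
    have "closed {r. laplacian \<phi> (polar r \<theta>) = R (polar r \<theta>)}"
      using continuous_closed_preimage_constant[OF continuous_on_diff[OF c] closed_UNIV, of \<theta> \<theta> 0] by simp
    moreover have "{0<..} \<subseteq> {r. laplacian \<phi> (polar r \<theta>) = R (polar r \<theta>)}" using * by auto
    ultimately have "closure {0<..} \<subseteq> {r. laplacian \<phi> (polar r \<theta>) = R (polar r \<theta>)}" by (rule closure_minimal[rotated])
    with r show "laplacian \<phi> x = R x" by (auto simp: closure_greaterThan)
  qed auto
  then show ?thesis using eq \<phi> by (auto simp: linearized_solution_def R_def)
qed

section \<open>Fourier coefficients of continuous periodic functions\<close>

definition fourier_coeff :: "int \<Rightarrow> (real \<Rightarrow> complex) \<Rightarrow> complex" where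
  "fourier_coeff k v = integral {0..2 * pi} (\<lambda>\<theta>. v \<theta> * cis (- (of_int k * \<theta>))) / of_real (2 * pi)"

inductive_set trig_poly :: "(real \<Rightarrow> complex) set" where
  cis: "(\<lambda>\<theta>. cis (of_int k * \<theta>)) \<in> trig_poly"
| scale: "p \<in> trig_poly \<Longrightarrow> (\<lambda>\<theta>. c * p \<theta>) \<in> trig_poly"
| add: "p \<in> trig_poly \<Longrightarrow> q \<in> trig_poly \<Longrightarrow> (\<lambda>\<theta>. p \<theta> + q \<theta>) \<in> trig_poly"

lemma trig_poly_continuous: "p \<in> trig_poly \<Longrightarrow> continuous_on A p"
  by (induction rule: trig_poly.induct) (auto intro!: continuous_intros)

lemma trig_poly_mult:
  assumes "p \<in> trig_poly" and q: "q \<in> trig_poly"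
  shows "(\<lambda>\<theta>. p \<theta> * q \<theta>) \<in> trig_poly"
  using assms(1)
proof (induction rule: trig_poly.induct)
  case (cis k)
  from q show ?case
  proof (induction rule: trig_poly.induct)
    case (cis j)
    have "(\<lambda>\<theta>. cis (of_int k * \<theta>) * cis (of_int j * \<theta>)) = (\<lambda>\<theta>. cis (of_int (k + j) * \<theta>))"
      by (simp add: cis_mult algebra_simps)
    then show ?case by (simp only: trig_poly.cis)
  next
    case (scale p c)
    from trig_poly.scale[OF this(2), of c] show ?case by (simp add: mult_ac)
  next
    case (add p q)
    from trig_poly.add[OF this(3,4)] show ?case by (simp add: algebra_simps)
  qed
next
  case (scale p c)
  from trig_poly.scale[OF this(2), of c] show ?case by (simp add: mult_ac)
next
  case (add p q)
  from trig_poly.add[OF this(3,4)] show ?case by (simp add: algebra_simps)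
qed

lemma trig_poly_const: "(\<lambda>\<theta>. c) \<in> trig_poly"
  using trig_poly.scale[OF trig_poly.cis[of 0], of c] by simp

lemma trig_poly_cos: "(\<lambda>\<theta>. of_real (cos \<theta>)) \<in> trig_poly"
proof -
  have "(\<lambda>\<theta>. (1/2) * (cis (of_int 1 * \<theta>) + cis (of_int (-1) * \<theta>))) \<in> trig_poly"
    by (intro trig_poly.intros)
  also have "(\<lambda>\<theta>. (1/2) * (cis (of_int 1 * \<theta>) + cis (of_int (-1) * \<theta>))) = (\<lambda>\<theta>. of_real (cos \<theta>))"
    by (auto simp: complex_eq_iff)
  finally show ?thesis .
qed

lemma trig_poly_sin: "(\<lambda>\<theta>. of_real (sin \<theta>)) \<in> trig_poly"
proof -
  have "(\<lambda>\<theta>. (1/(2*\<i>)) * (cis (of_int 1 * \<theta>) + (-1) * cis (of_int (-1) * \<theta>))) \<in> trig_poly"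
    by (intro trig_poly.intros)
  also have "(\<lambda>\<theta>. (1/(2*\<i>)) * (cis (of_int 1 * \<theta>) + (-1) * cis (of_int (-1) * \<theta>))) = (\<lambda>\<theta>. of_real (sin \<theta>))"
    by (auto simp: complex_eq_iff Re_divide Im_divide)
  finally show ?thesis .
qed

text \<open>Vanishing of all Fourier coefficients is orthogonality to the exponentials, hence to their span.\<close>

lemma integral_mult_trig_poly_eq_0:
  assumes "p \<in> trig_poly" and u: "continuous_on {0..2 * pi} u"
    and z: "\<And>k. fourier_coeff k u = 0"
  shows "integral {0..2 * pi} (\<lambda>\<theta>. u \<theta> * p \<theta>) = 0"
  using assms(1)
proof (induction rule: trig_poly.induct)
  case (cis k)
  from z[of "-k"] show ?case by (simp add: fourier_coeff_def)
next
  case (scale p c)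
  have "(\<lambda>\<theta>. u \<theta> * (c * p \<theta>)) = (\<lambda>\<theta>. c * (u \<theta> * p \<theta>))" by (simp add: mult_ac)
  with scale show ?case by simp
next
  case (add p q)
  have "(\<lambda>\<theta>. u \<theta> * p \<theta>) integrable_on {0..2 * pi}" "(\<lambda>\<theta>. u \<theta> * q \<theta>) integrable_on {0..2 * pi}"
    using u add trig_poly_continuous
    by (auto intro!: integrable_continuous_real continuous_intros)
  with add show ?case by (simp add: distrib_left integral_add)
qed

text \<open>Periodic functions are functions on the circle. Continuity of the factored map at the branch cut of
  the argument is the statement that a loop induces a continuous map of the circle.\<close>

lemma continuous_on_circle_of_periodic:
  fixes v :: "real \<Rightarrow> 'a::topological_space"
  assumes "continuous_on {0..2 * pi} v" and "v (2 * pi) = v 0"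
  obtains F where "continuous_on (sphere 0 1) F"
    and "\<And>\<theta>. 0 \<le> \<theta> \<Longrightarrow> \<theta> < 2 * pi \<Longrightarrow> F (cis \<theta>) = v \<theta>"
proof -
  define p where "p = (\<lambda>s. v (2 * pi * s))"
  have "path p"
    unfolding path_def p_def
    by (intro continuous_on_compose2[OF assms(1)] continuous_intros) (auto simp: mult_left_le)
  then have "homotopic_loops UNIV p p"
    using assms(2) by (simp add: homotopic_loops_refl pathstart_def pathfinish_def p_def)
  from homotopic_with_imp_continuous[OF homotopic_loops_imp_homotopic_circlemaps[OF this]]
  have "continuous_on (sphere 0 1) (p \<circ> (\<lambda>z. Arg2pi z / (2 * pi)))" by blast
  moreover have "(p \<circ> (\<lambda>z. Arg2pi z / (2 * pi))) (cis \<theta>) = v \<theta>" if "0 \<le> \<theta>" "\<theta> < 2 * pi" for \<theta>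
    using that Arg2pi_exp[of "\<i> * of_real \<theta>"] by (simp add: p_def cis_conv_exp)
  ultimately show thesis by (rule that)
qed

text \<open>Stone-Weierstrass on the unit circle: the real and imaginary part separate points, and they
  are \<open>cos\<close> and \<open>sin\<close> of the angle.\<close>

lemma trig_poly_approximation:
  fixes v :: "real \<Rightarrow> real"
  assumes "continuous_on {0..2 * pi} v" and "v (2 * pi) = v 0" and "e > 0"
  shows "\<exists>p. (\<lambda>\<theta>. of_real (p \<theta>)) \<in> trig_poly \<and> (\<forall>\<theta>. 0 \<le> \<theta> \<longrightarrow> \<theta> < 2 * pi \<longrightarrow> \<bar>v \<theta> - p \<theta>\<bar> < e)"
proof -
  obtain F where F: "continuous_on (sphere 0 1) F"
    and Fv: "\<And>\<theta>. 0 \<le> \<theta> \<Longrightarrow> \<theta> < 2 * pi \<Longrightarrow> F (cis \<theta>) = v \<theta>"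
    using continuous_on_circle_of_periodic[OF assms(1,2)] by blast
  define P where "P = (\<lambda>g::complex \<Rightarrow> real. continuous_on (sphere 0 1) g
      \<and> (\<lambda>\<theta>. of_real (g (cis \<theta>)) :: complex) \<in> trig_poly)"
  have "\<exists>g. P g \<and> (\<forall>x\<in>sphere 0 1. \<bar>F x - g x\<bar> < e)"
  proof (rule Stone_Weierstrass_HOL)
    show "P (\<lambda>x. c)" for c by (simp add: P_def trig_poly_const)
    show "P (\<lambda>x. f x + g x)" if "P f \<and> P g" for f g
      using that by (auto simp: P_def intro!: continuous_intros trig_poly.add)
    show "P (\<lambda>x. f x * g x)" if "P f \<and> P g" for f g
      using that by (auto simp: P_def intro!: continuous_intros trig_poly_mult)
    have "P Re" "P Im"
      by (auto simp: P_def trig_poly_cos trig_poly_sin intro!: continuous_intros)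
    then show "\<exists>f. P f \<and> f x \<noteq> f y" if "x \<in> sphere 0 1 \<and> y \<in> sphere 0 1 \<and> x \<noteq> y" for x y
      using that complex_eq_iff by blast
  qed (use F assms in \<open>auto simp: P_def\<close>)
  then obtain g where "P g" "\<And>x. x \<in> sphere 0 1 \<Longrightarrow> \<bar>F x - g x\<bar> < e" by blast
  with Fv show ?thesis unfolding P_def
    by (intro exI[of _ "\<lambda>\<theta>. g (cis \<theta>)"]) (metis dist_0_norm mem_sphere norm_cis)
qed

text \<open>By density of trigonometric polynomials \<open>u\<close> is orthogonal to every continuous periodic real
  function. Testing against \<open>Re u\<close> and \<open>Im u\<close> shows that both have zero square integral.\<close>

lemma fourier_coeff_zero_imp_zero:
  assumes u: "continuous_on {0..2 * pi} u" and per: "u (2 * pi) = u 0"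
    and z: "\<And>k. fourier_coeff k u = 0" and \<theta>: "\<theta> \<in> {0..2 * pi}"
  shows "u \<theta> = 0"
proof -
  have real_part: "integral {0..2 * pi} (\<lambda>\<theta>. u \<theta> * of_real (v \<theta>)) = 0"
    if v: "continuous_on {0..2 * pi} v" "v (2 * pi) = v 0" for v :: "real \<Rightarrow> real"
  proof -
    obtain M where M: "\<And>\<theta>. \<theta> \<in> {0..2 * pi} \<Longrightarrow> norm (u \<theta>) \<le> M"
      using compact_imp_bounded[OF compact_continuous_image[OF u compact_Icc]] unfolding bounded_iff
      by blast
    have M0: "M \<ge> 0" using order_trans[OF norm_ge_zero M[of 0]] by simp
    have small: "norm (integral {0..2 * pi} (\<lambda>\<theta>. u \<theta> * of_real (v \<theta>))) \<le> M * e * (2 * pi)"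
      if "e > 0" for e
    proof -
      obtain p where p: "(\<lambda>\<theta>. of_real (p \<theta>)) \<in> trig_poly"
        and ap: "\<And>\<theta>. 0 \<le> \<theta> \<Longrightarrow> \<theta> < 2 * pi \<Longrightarrow> \<bar>v \<theta> - p \<theta>\<bar> < e"
        using trig_poly_approximation[OF v \<open>e > 0\<close>] by blast
      have pc: "continuous_on {0..2 * pi} (\<lambda>\<theta>. complex_of_real (p \<theta>))"
        using trig_poly_continuous[OF p] .
      have int: "(\<lambda>\<theta>. u \<theta> * of_real (v \<theta>)) integrable_on {0..2 * pi}"
        "(\<lambda>\<theta>. u \<theta> * of_real (p \<theta>)) integrable_on {0..2 * pi}"
        using u v pc by (auto intro!: integrable_continuous_real continuous_intros)
      have "integral {0..2 * pi} (\<lambda>\<theta>. u \<theta> * of_real (v \<theta>))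
          = integral {0..2 * pi} (\<lambda>\<theta>. u \<theta> * of_real (v \<theta>) - u \<theta> * of_real (p \<theta>))"
        using integral_mult_trig_poly_eq_0[OF p u z] by (simp add: integral_diff[OF int])
      also have "norm \<dots> \<le> M * e * Henstock_Kurzweil_Integration.content (cbox 0 (2 * pi))"
      proof (rule has_integral_bound_spike_finite)
        show "((\<lambda>\<theta>. u \<theta> * of_real (v \<theta>) - u \<theta> * of_real (p \<theta>)) has_integral
            integral {0..2 * pi} (\<lambda>\<theta>. u \<theta> * of_real (v \<theta>) - u \<theta> * of_real (p \<theta>))) (cbox 0 (2 * pi))"
          using integrable_integral[OF integrable_diff[OF int]] by simp
        show "finite {2 * pi}" by simp
        show "norm (u x * of_real (v x) - u x * of_real (p x)) \<le> M * e"
          if "x \<in> cbox 0 (2 * pi) - {2 * pi}" for x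
        proof -
          have "u x * of_real (v x) - u x * of_real (p x) = u x * of_real (v x - p x)"
            by (simp add: algebra_simps)
          moreover have "norm (u x) * \<bar>v x - p x\<bar> \<le> M * e"
            using that M[of x] ap[of x] M0 by (intro mult_mono) (auto simp: less_imp_le)
          ultimately show ?thesis by (simp add: norm_mult del: of_real_diff)
        qed
      qed (use M0 that in auto)
      finally show ?thesis by simp
    qed
    have "norm (integral {0..2 * pi} (\<lambda>\<theta>. u \<theta> * of_real (v \<theta>))) \<le> 0"
    proof (rule field_le_epsilon)
      fix e :: real assume "e > 0"
      have "M * (e / ((M + 1) * (2 * pi))) * (2 * pi) = e * (M / (M + 1))"
        using M0 by (simp add: divide_simps)
      also have "\<dots> \<le> e * 1"
        using M0 \<open>e > 0\<close> by (intro mult_left_mono) auto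
      finally have "M * (e / ((M + 1) * (2 * pi))) * (2 * pi) \<le> e" by simp
      with small[of "e / ((M + 1) * (2 * pi))"] M0 \<open>e > 0\<close>
      show "norm (integral {0..2 * pi} (\<lambda>\<theta>. u \<theta> * of_real (v \<theta>))) \<le> 0 + e" by simp
    qed
    then show ?thesis by simp
  qed
  have cR: "continuous_on {0..2 * pi} (\<lambda>\<theta>. Re (u \<theta>))" and cI: "continuous_on {0..2 * pi} (\<lambda>\<theta>. Im (u \<theta>))"
    using u by (auto intro!: continuous_intros)
  have "Re (integral {0..2 * pi} (\<lambda>\<theta>. u \<theta> * of_real (Re (u \<theta>)))) = 0"
    using real_part[OF cR] per by simp
  moreover have "Im (integral {0..2 * pi} (\<lambda>\<theta>. u \<theta> * of_real (Im (u \<theta>)))) = 0"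
    using real_part[OF cI] per by simp
  moreover have "Re (integral {0..2 * pi} (\<lambda>\<theta>. u \<theta> * of_real (Re (u \<theta>))))
      = integral {0..2 * pi} (\<lambda>\<theta>. (Re (u \<theta>))\<^sup>2)"
  proof -
    have "(\<lambda>\<theta>. u \<theta> * of_real (Re (u \<theta>))) integrable_on {0..2 * pi}"
      by (intro integrable_continuous_real continuous_intros u)
    from integral_linear[OF this bounded_linear_Re] show ?thesis by (simp add: o_def power2_eq_square)
  qed
  moreover have "Im (integral {0..2 * pi} (\<lambda>\<theta>. u \<theta> * of_real (Im (u \<theta>))))
      = integral {0..2 * pi} (\<lambda>\<theta>. (Im (u \<theta>))\<^sup>2)"
  proof -
    have "(\<lambda>\<theta>. u \<theta> * of_real (Im (u \<theta>))) integrable_on {0..2 * pi}"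
      by (intro integrable_continuous_real continuous_intros u)
    from integral_linear[OF this bounded_linear_Im] show ?thesis by (simp add: o_def power2_eq_square)
  qed
  ultimately have "integral {0..2 * pi} (\<lambda>\<theta>. (Re (u \<theta>))\<^sup>2) = 0" "integral {0..2 * pi} (\<lambda>\<theta>. (Im (u \<theta>))\<^sup>2) = 0"
    by simp_all
  moreover have "(\<forall>\<theta>\<in>{0..2 * pi}. (v \<theta>)\<^sup>2 = 0)"
    if "continuous_on {0..2 * pi} v" "integral {0..2 * pi} (\<lambda>\<theta>. (v \<theta>)\<^sup>2) = 0" for v :: "real \<Rightarrow> real"
  proof -
    have "continuous_on {0..2 * pi} (\<lambda>\<theta>. (v \<theta>)\<^sup>2)" by (intro continuous_intros that)
    from integral_eq_0_iff[OF this] that(2) show ?thesis by simp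
  qed
  ultimately have "(Re (u \<theta>))\<^sup>2 = 0" "(Im (u \<theta>))\<^sup>2 = 0"
    using cR cI \<theta> by blast+
  then show ?thesis by (simp add: complex_eq_iff)
qed

lemma fourier_coeff_cis: "fourier_coeff k (\<lambda>\<theta>. cis (of_int j * \<theta>)) = (if j = k then 1 else 0)"
proof (cases "j = k")
  case True
  then show ?thesis by (simp add: fourier_coeff_def cis_mult scaleR_conv_of_real)
next
  case False
  define n where "n = real_of_int (j - k)"
  have n: "n \<noteq> 0" using False by (simp add: n_def)
  have "((\<lambda>\<theta>. cis (n * \<theta>)) has_integral (cis (n * (2 * pi)) / (\<i> * n) - cis (n * 0) / (\<i> * n))) {0..2 * pi}"
  proof (rule fundamental_theorem_of_calculus)
    show "((\<lambda>\<theta>. cis (n * \<theta>) / (\<i> * n)) has_vector_derivative cis (n * x)) (at x within {0..2 * pi})" for x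
    proof -
      have "((\<lambda>z. exp (\<i> * of_real n * z)) has_field_derivative exp (\<i> * of_real n * of_real x) * (\<i> * of_real n)) (at (of_real x))"
        by (auto intro!: derivative_eq_intros)
      from has_vector_derivative_real_field[OF DERIV_cdivide[OF this, of "\<i> * of_real n"]] n show ?thesis
        by (simp add: cis_conv_exp mult.assoc has_vector_derivative_at_within)
    qed
  qed simp
  moreover have "cis (n * (2 * pi)) = 1"
    using cis_multiple_2pi[of n] by (simp add: n_def mult_ac del: of_int_diff)
  ultimately have "integral {0..2 * pi} (\<lambda>\<theta>. cis (n * \<theta>)) = 0"
    by (simp add: integral_unique)
  moreover have "cis (of_int j * \<theta>) * cis (- (of_int k * \<theta>)) = cis (n * \<theta>)" for \<theta>
    by (simp add: cis_mult n_def algebra_simps)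
  ultimately show ?thesis using False by (simp add: fourier_coeff_def)
qed

lemma integrable_fourier:
  "continuous_on {0..2 * pi} u \<Longrightarrow> (\<lambda>\<theta>. u \<theta> * cis (- (of_int k * \<theta>))) integrable_on {0..2 * pi}"
  by (intro integrable_continuous_real continuous_intros)

lemma fourier_coeff_mult: "fourier_coeff k (\<lambda>\<theta>. c * u \<theta>) = c * fourier_coeff k u"
  by (simp add: fourier_coeff_def mult.assoc)

lemma fourier_coeff_add:
  assumes "continuous_on {0..2 * pi} u" "continuous_on {0..2 * pi} v"
  shows "fourier_coeff k (\<lambda>\<theta>. u \<theta> + v \<theta>) = fourier_coeff k u + fourier_coeff k v"
  using assms[THEN integrable_fourier, of k]
  by (simp add: fourier_coeff_def distrib_right integral_add add_divide_distrib)

lemma fourier_coeff_sum: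
  assumes "finite K"
  shows "fourier_coeff k (\<lambda>\<theta>. \<Sum>j\<in>K. c j * cis (of_int j * \<theta>)) = (if k \<in> K then c k else 0)"
  using assms
proof (induction K rule: finite_induct)
  case empty
  show ?case by (simp add: fourier_coeff_def)
next
  case (insert x K)
  have "fourier_coeff k (\<lambda>\<theta>. \<Sum>j\<in>insert x K. c j * cis (of_int j * \<theta>))
      = fourier_coeff k (\<lambda>\<theta>. c x * cis (of_int x * \<theta>)) + fourier_coeff k (\<lambda>\<theta>. \<Sum>j\<in>K. c j * cis (of_int j * \<theta>))"
    using insert.hyps
    by (subst fourier_coeff_add[symmetric]) (auto intro!: continuous_intros)
  with insert show ?case by (auto simp: fourier_coeff_mult fourier_coeff_cis)
qed

text \<open>The difference of the two sides has no nonzero Fourier coefficient.\<close>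

lemma finite_fourier_expansion:
  assumes u: "continuous_on UNIV u" and per: "\<And>\<theta>. u (\<theta> + 2 * pi) = u \<theta>"
    and K: "finite K" "\<And>k. k \<notin> K \<Longrightarrow> fourier_coeff k u = 0"
  shows "u \<theta> = (\<Sum>k\<in>K. fourier_coeff k u * cis (of_int k * \<theta>))"
proof -
  define v where "v = (\<lambda>\<theta>. u \<theta> + (-1) * (\<Sum>k\<in>K. fourier_coeff k u * cis (of_int k * \<theta>)))"
  have uc: "continuous_on A u" for A using u continuous_on_subset by blast
  have vc: "continuous_on A v" for A
    unfolding v_def by (intro continuous_intros uc)
  have vper: "v (\<theta> + 2 * pi) = v \<theta>" for \<theta>
  proof -
    have "cis (of_int k * (\<theta> + 2 * pi)) = cis (of_int k * \<theta>)" for k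
      using cis_multiple_2pi[of "of_int k"] by (simp add: distrib_left mult_ac flip: cis_mult)
    then show ?thesis by (simp add: v_def per)
  qed
  have coeff: "fourier_coeff k v = 0" for k
  proof -
    have "fourier_coeff k v = fourier_coeff k u
        + fourier_coeff k (\<lambda>\<theta>. (-1) * (\<Sum>k\<in>K. fourier_coeff k u * cis (of_int k * \<theta>)))"
      unfolding v_def by (intro fourier_coeff_add continuous_intros uc)
    also have "\<dots> = 0"
      unfolding fourier_coeff_mult fourier_coeff_sum[OF K(1)] using K(2) by auto
    finally show ?thesis .
  qed
  have v0: "v x = 0" if "x \<in> {0..2 * pi}" for x
    using fourier_coeff_zero_imp_zero[OF vc _ coeff that] vper[of 0] by simp
  have "v \<theta> = v (\<theta> + 2 * pi * of_int n)" for n :: int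
  proof (induction n rule: int_induct[where k = 0])
    case (step1 i)
    with vper[of "\<theta> + 2 * pi * of_int i"] show ?case by (simp add: algebra_simps)
  next
    case (step2 i)
    with vper[of "\<theta> + 2 * pi * of_int (i - 1)"] show ?case by (simp add: algebra_simps)
  qed simp
  from this[of "- \<lfloor>\<theta> / (2 * pi)\<rfloor>"]
  have "v \<theta> = v (2 * pi * frac (\<theta> / (2 * pi)))" by (simp add: frac_def algebra_simps)
  also have "\<dots> = 0"
    by (rule v0) (auto simp: frac_ge_0 less_imp_le[OF frac_lt_1] mult_left_le)
  finally show ?thesis by (simp add: v_def)
qed

lemma norm_fourier_coeff_le:
  assumes "continuous_on UNIV u" and "\<And>\<theta>. norm (u \<theta>) \<le> B"
  shows "norm (fourier_coeff k u) \<le> B"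
proof -
  have "continuous_on {0..2 * pi} u" using assms(1) continuous_on_subset by blast
  from has_integral_bound[OF _ integrable_integral[OF integrable_fourier[OF this, of k], unfolded box_real[symmetric]], of B]
  have "norm (integral {0..2 * pi} (\<lambda>\<theta>. u \<theta> * cis (- (of_int k * \<theta>)))) \<le> B * (2 * pi)"
    using assms(2) order_trans[OF norm_ge_zero assms(2)] by (simp add: norm_mult)
  then show ?thesis by (simp add: fourier_coeff_def norm_divide norm_mult field_simps)
qed

text \<open>Integration by parts; the boundary terms cancel by periodicity.\<close>

lemma fourier_coeff_deriv_angle:
  assumes u: "\<And>\<theta>. (u has_vector_derivative u' \<theta>) (at \<theta>)" and u': "continuous_on UNIV u'"
    and per: "\<And>\<theta>. u (\<theta> + 2 * pi) = u \<theta>"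
  shows "fourier_coeff k u' = \<i> * of_int k * fourier_coeff k u"
proof -
  define e where "e = (\<lambda>\<theta>. cis (- (of_int k * \<theta>)))"
  define e' where "e' = (\<lambda>\<theta>. - (\<i> * of_int k) * e \<theta>)"
  have e: "(e has_vector_derivative e' \<theta>) (at \<theta>)" for \<theta>
    unfolding e_def e'_def cis_conv_exp
    by (auto intro!: derivative_eq_intros has_vector_derivative_real_field)
  have uc: "continuous_on A u" for A
    using u by (meson continuous_at_imp_continuous_on has_vector_derivative_continuous)
  have ec: "continuous_on A e" for A
    unfolding e_def by (intro continuous_intros)
  have ints: "(\<lambda>\<theta>. u \<theta> * e \<theta>) integrable_on {0..2 * pi}" "(\<lambda>\<theta>. u' \<theta> * e \<theta>) integrable_on {0..2 * pi}"
    using integrable_fourier[OF uc, of k] integrable_fourier[of u' k] continuous_on_subset[OF u']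
    unfolding e_def by auto
  have "((\<lambda>\<theta>. u \<theta> * e' \<theta> + u' \<theta> * e \<theta>) has_integral u (2 * pi) * e (2 * pi) - u 0 * e 0) {0..2 * pi}"
    by (rule fundamental_theorem_of_calculus)
       (auto intro!: has_vector_derivative_mult u e intro: has_vector_derivative_at_within)
  moreover have "u (2 * pi) = u 0" using per[of 0] by simp
  moreover have "e (2 * pi) = 1" "e 0 = 1"
    using cis_multiple_2pi[of "of_int (-k)"] by (auto simp: e_def mult_ac)
  ultimately have "integral {0..2 * pi} (\<lambda>\<theta>. - (\<i> * of_int k) * (u \<theta> * e \<theta>) + u' \<theta> * e \<theta>) = 0"
    by (simp add: integral_unique e'_def mult_ac)
  then have "- (\<i> * of_int k) * integral {0..2 * pi} (\<lambda>\<theta>. u \<theta> * e \<theta>) + integral {0..2 * pi} (\<lambda>\<theta>. u' \<theta> * e \<theta>) = 0"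
    using integral_add[OF integrable_on_mult_right[OF ints(1)] ints(2), of "- (\<i> * of_int k)"] by simp
  then show ?thesis by (simp add: fourier_coeff_def e_def add_eq_0_iff)
qed

lemma fourier_coeff_deriv_param:
  assumes u: "\<And>t \<theta>. ((\<lambda>t. u t \<theta>) has_vector_derivative ut t \<theta>) (at t)"
    and c: "\<And>t. continuous_on UNIV (u t)" "continuous_on UNIV (\<lambda>(t, \<theta>). ut t \<theta>)"
  shows "((\<lambda>t. fourier_coeff k (u t)) has_vector_derivative fourier_coeff k (ut t)) (at t)"
proof -
  have "((\<lambda>t. integral (cbox 0 (2 * pi)) (\<lambda>\<theta>. u t \<theta> * cis (- (of_int k * \<theta>))))
      has_vector_derivative integral (cbox 0 (2 * pi)) (\<lambda>\<theta>. ut t \<theta> * cis (- (of_int k * \<theta>)))) (at t within UNIV)"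
  proof (rule leibniz_rule_vector_derivative)
    show "((\<lambda>t. u t \<theta> * cis (- (of_int k * \<theta>))) has_vector_derivative ut t \<theta> * cis (- (of_int k * \<theta>))) (at t within UNIV)" for t \<theta>
      using has_vector_derivative_mult_left[OF u] by simp
    show "(\<lambda>\<theta>. u t \<theta> * cis (- (of_int k * \<theta>))) integrable_on cbox 0 (2 * pi)" for t
      using integrable_fourier[OF continuous_on_subset[OF c(1)]] by simp
    have "continuous_on (UNIV \<times> cbox 0 (2 * pi)) (\<lambda>z. (case z of (t, \<theta>) \<Rightarrow> ut t \<theta>) * cis (- (of_int k * snd z)))"
      by (intro continuous_intros continuous_on_subset[OF c(2)]) auto
    then show "continuous_on (UNIV \<times> cbox 0 (2 * pi)) (\<lambda>(t, \<theta>). ut t \<theta> * cis (- (of_int k * \<theta>)))"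
      by (simp add: case_prod_beta')
  qed auto
  from has_vector_derivative_divide[OF this, of "of_real (2 * pi)"]
  show ?thesis by (simp add: fourier_coeff_def)
qed

section \<open>Functions on the cylinder\<close>

text \<open>A function of \<open>t\<close> and the angle \<open>\<theta>\<close> together with its first and its pure second derivatives, which
  are the ones occurring in the Laplacian. The derivatives are arguments so that closure
  rules produce explicit formulas for them.\<close>

definition cylinder_C2 :: "(real \<Rightarrow> real \<Rightarrow> 'b::real_normed_vector) \<Rightarrow> (real \<Rightarrow> real \<Rightarrow> 'b) \<Rightarrow>
    (real \<Rightarrow> real \<Rightarrow> 'b) \<Rightarrow> (real \<Rightarrow> real \<Rightarrow> 'b) \<Rightarrow> (real \<Rightarrow> real \<Rightarrow> 'b) \<Rightarrow> bool" where
  "cylinder_C2 u ut us utt uss \<longleftrightarrow>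
     (\<forall>t \<theta>. ((\<lambda>t. u t \<theta>) has_vector_derivative ut t \<theta>) (at t) \<and>
            ((\<lambda>t. ut t \<theta>) has_vector_derivative utt t \<theta>) (at t) \<and>
            (u t has_vector_derivative us t \<theta>) (at \<theta>) \<and>
            (us t has_vector_derivative uss t \<theta>) (at \<theta>) \<and>
            u t (\<theta> + 2 * pi) = u t \<theta> \<and> us t (\<theta> + 2 * pi) = us t \<theta>) \<and>
     (\<forall>v\<in>{u, ut, us, utt, uss}. continuous_on UNIV (\<lambda>z. v (fst z) (snd z)))"

lemma cylinder_C2D:
  assumes "cylinder_C2 u ut us utt uss"
  shows "((\<lambda>t. u t \<theta>) has_vector_derivative ut t \<theta>) (at t)"
    "((\<lambda>t. ut t \<theta>) has_vector_derivative utt t \<theta>) (at t)"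
    "(u t has_vector_derivative us t \<theta>) (at \<theta>)"
    "(us t has_vector_derivative uss t \<theta>) (at \<theta>)"
    "u t (\<theta> + 2 * pi) = u t \<theta>" "us t (\<theta> + 2 * pi) = us t \<theta>"
    "continuous_on UNIV (\<lambda>z. u (fst z) (snd z))" "continuous_on UNIV (\<lambda>z. ut (fst z) (snd z))"
    "continuous_on UNIV (\<lambda>z. us (fst z) (snd z))" "continuous_on UNIV (\<lambda>z. utt (fst z) (snd z))"
    "continuous_on UNIV (\<lambda>z. uss (fst z) (snd z))"
  using assms unfolding cylinder_C2_def by auto

lemma continuous_on_slice:
  assumes "continuous_on UNIV (\<lambda>z. v (fst z) (snd z))"
  shows "continuous_on A (v t)"
proof -
  have "continuous_on A (\<lambda>\<theta>. (t, \<theta>))" by (intro continuous_intros)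
  from continuous_on_compose2[OF assms this] show ?thesis by simp
qed

lemma cylinder_C2_bilinear:
  assumes bil: "bounded_bilinear pr"
    and u: "cylinder_C2 u ut us utt uss" and v: "cylinder_C2 v vt vs vtt vss"
  shows "cylinder_C2 (\<lambda>t \<theta>. pr (u t \<theta>) (v t \<theta>))
     (\<lambda>t \<theta>. pr (u t \<theta>) (vt t \<theta>) + pr (ut t \<theta>) (v t \<theta>))
     (\<lambda>t \<theta>. pr (u t \<theta>) (vs t \<theta>) + pr (us t \<theta>) (v t \<theta>))
     (\<lambda>t \<theta>. (pr (u t \<theta>) (vtt t \<theta>) + pr (ut t \<theta>) (vt t \<theta>)) + (pr (ut t \<theta>) (vt t \<theta>) + pr (utt t \<theta>) (v t \<theta>)))
     (\<lambda>t \<theta>. (pr (u t \<theta>) (vss t \<theta>) + pr (us t \<theta>) (vs t \<theta>)) + (pr (us t \<theta>) (vs t \<theta>) + pr (uss t \<theta>) (v t \<theta>)))"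
  unfolding cylinder_C2_def
  by (safe; (simp only: cylinder_C2D(5,6)[OF u] cylinder_C2D(5,6)[OF v])?;
      intro has_vector_derivative_add bounded_bilinear.has_vector_derivative[OF bil] cylinder_C2D(1-4)[OF u] cylinder_C2D(1-4)[OF v]
        continuous_on_add bounded_bilinear.continuous_on[OF bil] cylinder_C2D(7-11)[OF u] cylinder_C2D(7-11)[OF v])

lemma cylinder_C2_Complex:
  assumes a: "cylinder_C2 a at' as att ass" and b: "cylinder_C2 b bt bs btt bss"
  shows "cylinder_C2 (\<lambda>t \<theta>. of_real (a t \<theta>) + \<i> * of_real (b t \<theta>)) (\<lambda>t \<theta>. of_real (at' t \<theta>) + \<i> * of_real (bt t \<theta>))
     (\<lambda>t \<theta>. of_real (as t \<theta>) + \<i> * of_real (bs t \<theta>)) (\<lambda>t \<theta>. of_real (att t \<theta>) + \<i> * of_real (btt t \<theta>))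
     (\<lambda>t \<theta>. of_real (ass t \<theta>) + \<i> * of_real (bss t \<theta>))"
  unfolding cylinder_C2_def
  by (safe; (simp only: cylinder_C2D(5,6)[OF a] cylinder_C2D(5,6)[OF b])?;
      intro has_vector_derivative_add has_vector_derivative_mult_right has_vector_derivative_of_real
        
        cylinder_C2D(1-4)[OF a, folded has_real_derivative_iff_has_vector_derivative]
        cylinder_C2D(1-4)[OF b, folded has_real_derivative_iff_has_vector_derivative]
        continuous_intros cylinder_C2D(7-11)[OF a] cylinder_C2D(7-11)[OF b])

lemma fourier_coeff_cylinder:
  assumes u: "cylinder_C2 u ut us utt uss"
  shows "((\<lambda>t. fourier_coeff k (u t)) has_vector_derivative fourier_coeff k (ut t)) (at t)"
    "((\<lambda>t. fourier_coeff k (ut t)) has_vector_derivative fourier_coeff k (utt t)) (at t)"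
    "fourier_coeff k (us t) = \<i> * of_int k * fourier_coeff k (u t)"
    "fourier_coeff k (uss t) = - (of_int k)\<^sup>2 * fourier_coeff k (u t)"
proof -
  note D = cylinder_C2D[OF u]
  show "((\<lambda>t. fourier_coeff k (u t)) has_vector_derivative fourier_coeff k (ut t)) (at t)"
    by (rule fourier_coeff_deriv_param[OF D(1)]) (use D(7,8) in \<open>auto simp: case_prod_beta' intro: continuous_on_slice\<close>)
  show "((\<lambda>t. fourier_coeff k (ut t)) has_vector_derivative fourier_coeff k (utt t)) (at t)"
    by (rule fourier_coeff_deriv_param[OF D(2)]) (use D(8,10) in \<open>auto simp: case_prod_beta' intro: continuous_on_slice\<close>)
  show *: "fourier_coeff k (us t) = \<i> * of_int k * fourier_coeff k (u t)"
    by (rule fourier_coeff_deriv_angle[OF D(3) continuous_on_slice[OF D(9)] D(5)])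
  have "fourier_coeff k (uss t) = \<i> * of_int k * fourier_coeff k (us t)"
    by (rule fourier_coeff_deriv_angle[OF D(4) continuous_on_slice[OF D(11)] D(6)])
  then show "fourier_coeff k (uss t) = - (of_int k)\<^sup>2 * fourier_coeff k (u t)"
    unfolding * by (simp add: power2_eq_square algebra_simps)
qed

text \<open>Vectors given by their components in the frame that rotates about the third axis with angle
  \<open>m \<theta>\<close>: \<open>a\<close> is the radial, \<open>c\<close> the angular and \<open>b\<close> the vertical component. The frame
  \<open>W\<close>, \<open>E\<^sub>1\<close>, \<open>E\<^sub>2\<close> has components that depend on \<open>t\<close> alone, so differentiation in \<open>\<theta>\<close> and cross products
  become algebra in the components.\<close>

definition rot :: "nat \<Rightarrow> real \<Rightarrow> real \<Rightarrow> real \<Rightarrow> real \<Rightarrow> real^3" where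
  "rot m \<theta> a c b = vector [a * cos (real m * \<theta>) - c * sin (real m * \<theta>),
                          a * sin (real m * \<theta>) + c * cos (real m * \<theta>), b]"

lemma rot_add: "rot m \<theta> a c b + rot m \<theta> a' c' b' = rot m \<theta> (a + a') (c + c') (b + b')"
  by (simp add: rot_def vec_eq_iff forall_3 algebra_simps)

lemma rot_scaleR: "k *\<^sub>R rot m \<theta> a c b = rot m \<theta> (k * a) (k * c) (k * b)"
  by (simp add: rot_def vec_eq_iff forall_3 algebra_simps)

lemma rot_cross: "cross3 (rot m \<theta> a c b) (rot m \<theta> a' c' b')
    = rot m \<theta> (c * b' - b * c') (b * a' - a * b') (a * c' - c * a')"
proof -
  define p q where "p = cos (real m * \<theta>)" and "q = sin (real m * \<theta>)"
  have pq: "p * p + q * q = 1" by (simp add: p_def q_def)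
  show ?thesis
    unfolding rot_def p_def[symmetric] q_def[symmetric] vec_eq_iff forall_3 cross3_def vector_3
  proof (intro conjI)
    have "(a * p - c * q) * (a' * q + c' * p) - (a * q + c * p) * (a' * p - c' * q)
        = (a * c' - c * a') * (p * p + q * q)"
      by (simp add: algebra_simps)
    then show "(a * p - c * q) * (a' * q + c' * p) - (a * q + c * p) * (a' * p - c' * q) = a * c' - c * a'"
      by (simp add: pq)
  qed (simp_all add: algebra_simps)
qed

lemma rot_inner: "rot m \<theta> a c b \<bullet> rot m \<theta> a' c' b' = a * a' + c * c' + b * b'"
proof -
  define p q where "p = cos (real m * \<theta>)" and "q = sin (real m * \<theta>)"
  have pq: "p * p + q * q = 1" by (simp add: p_def q_def)
  show ?thesis
    unfolding rot_def p_def[symmetric] q_def[symmetric] inner_vec_def sum_3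
    using pq by (simp, algebra)
qed

lemma norm_rot: "norm (rot m \<theta> a c b) = sqrt (a\<^sup>2 + c\<^sup>2 + b\<^sup>2)"
  by (simp add: norm_eq_sqrt_inner rot_inner power2_eq_square)

lemma rot_axis: "rot m \<theta> a c b = (a * cos (real m * \<theta>) - c * sin (real m * \<theta>)) *\<^sub>R axis 1 1
   + (a * sin (real m * \<theta>) + c * cos (real m * \<theta>)) *\<^sub>R axis 2 1 + b *\<^sub>R axis 3 1"
  unfolding rot_def vector_3_axis ..

text \<open>Expansion in the orthonormal basis \<open>W\<close>, \<open>E\<^sub>1\<close>, \<open>E\<^sub>2\<close>.\<close>

lemma rot_expansion:
  assumes "S\<^sup>2 + T\<^sup>2 = (1::real)"
  shows "X = (X \<bullet> rot m \<theta> S 0 T) *\<^sub>R rot m \<theta> S 0 T + (X \<bullet> rot m \<theta> T 0 (- S)) *\<^sub>R rot m \<theta> T 0 (- S)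
     + (X \<bullet> rot m \<theta> 0 1 0) *\<^sub>R rot m \<theta> 0 1 0"
proof -
  define p q where "p = cos (real m * \<theta>)" and "q = sin (real m * \<theta>)"
  have pq: "p * p + q * q = 1" by (simp add: p_def q_def)
  show ?thesis
    unfolding rot_def p_def[symmetric] q_def[symmetric] vec_eq_iff forall_3 inner_vec_def sum_3
    using pq assms by (simp, intro conjI; algebra)
qed

lemma has_vector_derivative_rot_t:
  assumes "(a has_real_derivative a') (at t)" "(c has_real_derivative c') (at t)" "(b has_real_derivative b') (at t)"
  shows "((\<lambda>t. rot m \<theta> (a t) (c t) (b t)) has_vector_derivative rot m \<theta> a' c' b') (at t)"
  unfolding rot_axis
  by (intro has_vector_derivative_add derivative_intros assms
      has_vector_derivative_scaleR[where g' = 0, simplified])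
    (auto intro!: derivative_eq_intros assms)

lemma has_vector_derivative_rot_angle:
  "((\<lambda>\<theta>. rot m \<theta> a c b) has_vector_derivative rot m \<theta> (real m * - c) (real m * a) 0) (at \<theta>)"
proof -
  have "((\<lambda>\<theta>. rot m \<theta> a c b) has_vector_derivative
     (a * (- sin (real m * \<theta>) * real m) - c * (cos (real m * \<theta>) * real m)) *\<^sub>R axis 1 1 +
     (a * (cos (real m * \<theta>) * real m) + c * (- sin (real m * \<theta>) * real m)) *\<^sub>R axis 2 1 + 0 *\<^sub>R axis 3 1) (at \<theta>)"
    unfolding rot_axis
    by (intro has_vector_derivative_add has_vector_derivative_scaleR[where g' = 0, simplified] derivative_intros)
       (auto intro!: derivative_eq_intros)
  moreover have "(a * (- sin (real m * \<theta>) * real m) - c * (cos (real m * \<theta>) * real m)) *\<^sub>R axis 1 1 +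
     (a * (cos (real m * \<theta>) * real m) + c * (- sin (real m * \<theta>) * real m)) *\<^sub>R axis 2 1 + 0 *\<^sub>R axis 3 1
    = rot m \<theta> (real m * - c) (real m * a) 0"
    unfolding rot_axis by (simp add: algebra_simps)
  ultimately show ?thesis by simp
qed

lemma rot_periodic: "rot m (\<theta> + 2 * pi) a c b = rot m \<theta> a c b"
proof -
  have "cis (real m * (\<theta> + 2 * pi)) = cis (real m * \<theta>)"
    using cis_multiple_2pi[of "real m"] by (simp add: distrib_left mult_ac flip: cis_mult)
  then show ?thesis by (simp add: rot_def complex_eq_iff)
qed

lemma continuous_on_rot:
  fixes h :: "'a::t2_space \<Rightarrow> real"
  assumes "continuous_on A a" "continuous_on A c" "continuous_on A b" "continuous_on A h"
  shows "continuous_on A (\<lambda>x. rot m (h x) (a x) (c x) (b x))"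
  unfolding rot_axis by (intro continuous_intros assms)

lemma cylinder_C2_rot:
  assumes a: "\<And>t. (a has_real_derivative a1 t) (at t)" "\<And>t. (a1 has_real_derivative a2 t) (at t)" "continuous_on UNIV a2"
    and c: "\<And>t. (c has_real_derivative c1 t) (at t)" "\<And>t. (c1 has_real_derivative c2 t) (at t)" "continuous_on UNIV c2"
    and b: "\<And>t. (b has_real_derivative b1 t) (at t)" "\<And>t. (b1 has_real_derivative b2 t) (at t)" "continuous_on UNIV b2"
  shows "cylinder_C2 (\<lambda>t \<theta>. rot m \<theta> (a t) (c t) (b t)) (\<lambda>t \<theta>. rot m \<theta> (a1 t) (c1 t) (b1 t))
     (\<lambda>t \<theta>. rot m \<theta> (real m * - c t) (real m * a t) 0)
     (\<lambda>t \<theta>. rot m \<theta> (a2 t) (c2 t) (b2 t))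
     (\<lambda>t \<theta>. rot m \<theta> (real m * - (real m * a t)) (real m * (real m * - c t)) 0)"
proof -
  have cont: "continuous_on UNIV f" if "\<And>t. (f has_real_derivative f' t) (at t)" for f f' :: "real \<Rightarrow> real"
    using that by (meson DERIV_isCont continuous_at_imp_continuous_on)
  have cf: "continuous_on UNIV (\<lambda>z. f (fst z))" if "continuous_on UNIV f" for f :: "real \<Rightarrow> real"
    by (rule continuous_on_compose2[OF that]) (auto intro!: continuous_intros)
  note cc = cf[OF cont[OF a(1)]] cf[OF cont[OF a(2)]] cf[OF a(3)] cf[OF cont[OF c(1)]] cf[OF cont[OF c(2)]] cf[OF c(3)]
    cf[OF cont[OF b(1)]] cf[OF cont[OF b(2)]] cf[OF b(3)]
  show ?thesis
    unfolding cylinder_C2_def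
    by (safe; (simp only: rot_periodic)?;
      intro has_vector_derivative_rot_t a c b has_vector_derivative_rot_angle continuous_on_rot cc continuous_intros)
qed

definition cyl :: "(real^2 \<Rightarrow> 'b) \<Rightarrow> real \<Rightarrow> real \<Rightarrow> 'b" where
  "cyl u t \<theta> = u (polar (exp t) \<theta>)"

text \<open>The derivatives of \<^term>\<open>cyl u\<close> with respect to \<open>t\<close> and \<open>\<theta>\<close>, by the chain rule
  from the partial derivatives of \<open>u\<close>.\<close>

definition cyl_t :: "(real^2 \<Rightarrow> 'b::real_normed_vector) \<Rightarrow> real \<Rightarrow> real \<Rightarrow> 'b" where
  "cyl_t u t \<theta> = exp t *\<^sub>R (cos \<theta> *\<^sub>R partial 1 u (polar (exp t) \<theta>) + sin \<theta> *\<^sub>R partial 2 u (polar (exp t) \<theta>))"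

definition cyl_s :: "(real^2 \<Rightarrow> 'b::real_normed_vector) \<Rightarrow> real \<Rightarrow> real \<Rightarrow> 'b" where
  "cyl_s u t \<theta> = exp t *\<^sub>R ((- sin \<theta>) *\<^sub>R partial 1 u (polar (exp t) \<theta>) + cos \<theta> *\<^sub>R partial 2 u (polar (exp t) \<theta>))"

definition cyl_tt :: "(real^2 \<Rightarrow> 'b::real_normed_vector) \<Rightarrow> real \<Rightarrow> real \<Rightarrow> 'b" where
  "cyl_tt u t \<theta> = exp t *\<^sub>R (cos \<theta> *\<^sub>R cyl_t (partial 1 u) t \<theta> + sin \<theta> *\<^sub>R cyl_t (partial 2 u) t \<theta>) + cyl_t u t \<theta>"

definition cyl_ss :: "(real^2 \<Rightarrow> 'b::real_normed_vector) \<Rightarrow> real \<Rightarrow> real \<Rightarrow> 'b" where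
  "cyl_ss u t \<theta> = exp t *\<^sub>R ((- sin \<theta>) *\<^sub>R cyl_s (partial 1 u) t \<theta> + cos \<theta> *\<^sub>R cyl_s (partial 2 u) t \<theta>) - cyl_t u t \<theta>"

lemma cyl_derivative:
  assumes "has_partials u (partial 1 u) (partial 2 u)"
  shows "((\<lambda>t. u (polar (exp t) \<theta>)) has_vector_derivative cyl_t u t \<theta>) (at t)"
    "((\<lambda>\<theta>. u (polar (exp t) \<theta>)) has_vector_derivative cyl_s u t \<theta>) (at \<theta>)"
proof -
  have "((\<lambda>t. polar (exp t) \<theta>) has_vector_derivative exp t *\<^sub>R polar 1 \<theta>) (at t)"
    using vector_diff_chain_at[OF _ polar_radial_derivative, of exp "exp t" t] DERIV_exp[of t]
    by (simp add: o_def has_real_derivative_iff_has_vector_derivative)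
  from has_partials_chain[OF assms this]
  show "((\<lambda>t. u (polar (exp t) \<theta>)) has_vector_derivative cyl_t u t \<theta>) (at t)"
    by (simp add: cyl_t_def scaleR_add_right)
  show "((\<lambda>\<theta>. u (polar (exp t) \<theta>)) has_vector_derivative cyl_s u t \<theta>) (at \<theta>)"
    using has_partials_chain[OF assms polar_angular_derivative]
    by (simp add: cyl_s_def scaleR_diff_right)
qed

lemma polar_periodic: "polar r (\<theta> + 2 * pi) = polar r \<theta>"
  by (simp add: polar_def)

lemma cylinder_C2_polar:
  fixes \<phi> :: "real^2 \<Rightarrow> 'b::real_normed_vector"
  assumes "C2 \<phi>"
  shows "cylinder_C2 (\<lambda>t \<theta>. \<phi> (polar (exp t) \<theta>)) (cyl_t \<phi>) (cyl_s \<phi>) (cyl_tt \<phi>) (cyl_ss \<phi>)"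
proof -
  note d = cyl_derivative[OF C2D(1)[OF assms]] and d2 = cyl_derivative[OF C2D(2)[OF assms]]
  have sc: "(cos has_real_derivative - sin \<theta>) (at \<theta>)" "((\<lambda>\<theta>. - sin \<theta>) has_real_derivative - cos \<theta>) (at \<theta>)"
    "(sin has_real_derivative cos \<theta>) (at \<theta>)" for \<theta> :: real
    by (auto intro!: derivative_eq_intros)
  have tt: "((\<lambda>t. cyl_t \<phi> t \<theta>) has_vector_derivative cyl_tt \<phi> t \<theta>) (at t)" for t \<theta>
    using has_vector_derivative_scaleR[OF DERIV_exp[of t] has_vector_derivative_add[OF
        bounded_linear.has_vector_derivative[OF bounded_linear_scaleR_right d2(1)[of 1 \<theta> t], of "cos \<theta>"]
        bounded_linear.has_vector_derivative[OF bounded_linear_scaleR_right d2(1)[of 2 \<theta> t], of "sin \<theta>"]]]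
    unfolding cyl_tt_def cyl_t_def[of \<phi>] .
  have ss: "(cyl_s \<phi> t has_vector_derivative cyl_ss \<phi> t \<theta>) (at \<theta>)" for t \<theta>
  proof -
    have "(cyl_s \<phi> t has_vector_derivative exp t *\<^sub>R
        (((- sin \<theta>) *\<^sub>R cyl_s (partial 1 \<phi>) t \<theta> + (- cos \<theta>) *\<^sub>R partial 1 \<phi> (polar (exp t) \<theta>))
       + (cos \<theta> *\<^sub>R cyl_s (partial 2 \<phi>) t \<theta> + (- sin \<theta>) *\<^sub>R partial 2 \<phi> (polar (exp t) \<theta>)))) (at \<theta>)"
      unfolding cyl_s_def[of \<phi>, abs_def]
      by (intro bounded_linear.has_vector_derivative[OF bounded_linear_scaleR_right] has_vector_derivative_add
          has_vector_derivative_scaleR sc d2)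
    then show ?thesis by (simp add: cyl_ss_def cyl_t_def algebra_simps)
  qed
  have c: "continuous_on UNIV (\<lambda>z. f (polar (exp (fst z)) (snd z)))" if "continuous_on UNIV f"
    for f :: "real^2 \<Rightarrow> 'b"
    by (rule continuous_on_polar[OF that]) (intro continuous_intros)+
  note c' = c[OF has_partials_continuous[OF C2D(1)[OF assms]]] c[OF C2D(3)[OF assms]] c[OF C2D(4)[OF assms]]
  show ?thesis
    unfolding cylinder_C2_def
    apply (intro conjI allI ballI d tt ss polar_periodic[THEN arg_cong])
    subgoal by (simp add: cyl_s_def polar_periodic)
    subgoal by (auto simp: cyl_t_def cyl_s_def cyl_tt_def cyl_ss_def intro!: continuous_intros c')
    done
qed

text \<open>Conformal invariance of the Laplacian. The mixed derivatives and the first derivatives enter the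
  two summands with opposite signs and cancel.\<close>

lemma cyl_laplacian:
  fixes \<phi> :: "real^2 \<Rightarrow> 'b::real_normed_vector"
  shows "cyl_tt \<phi> t \<theta> + cyl_ss \<phi> t \<theta> = (exp t)\<^sup>2 *\<^sub>R laplacian \<phi> (polar (exp t) \<theta>)"
proof -
  have "cyl_tt \<phi> t \<theta> + cyl_ss \<phi> t \<theta>
     = ((exp t)\<^sup>2 * ((cos \<theta>)\<^sup>2 + (sin \<theta>)\<^sup>2)) *\<^sub>R laplacian \<phi> (polar (exp t) \<theta>)"
    unfolding cyl_tt_def cyl_ss_def cyl_t_def cyl_s_def laplacian_2
    by (simp add: algebra_simps power2_eq_square del: sin_cos_squared_add2 sin_cos_squared_add3 sin_cos_squared_add)
  then show ?thesis by simp
qed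

lemma cyl_equation:
  assumes "linearized_solution w \<phi>"
  shows "cyl_tt \<phi> t \<theta> + cyl_ss \<phi> t \<theta>
     = 2 *\<^sub>R (cross3 (cyl_t w t \<theta>) (cyl_s \<phi> t \<theta>) + cross3 (cyl_t \<phi> t \<theta>) (cyl_s w t \<theta>))"
proof -
  let ?x = "polar (exp t) \<theta>"
  have "cyl_tt \<phi> t \<theta> + cyl_ss \<phi> t \<theta> = (exp t)\<^sup>2 *\<^sub>R laplacian \<phi> ?x" by (rule cyl_laplacian)
  also have "laplacian \<phi> ?x = 2 *\<^sub>R (cross3 (partial 1 w ?x) (partial 2 \<phi> ?x) + cross3 (partial 1 \<phi> ?x) (partial 2 w ?x))"
    using assms by (simp add: linearized_solution_def)
  also have "(exp t)\<^sup>2 *\<^sub>R \<dots> = 2 *\<^sub>R (exp t *\<^sub>R (exp t *\<^sub>R (cross3 (partial 1 w ?x) (partial 2 \<phi> ?x) + cross3 (partial 1 \<phi> ?x) (partial 2 w ?x))))"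
    by (simp add: power2_eq_square mult_ac)
  also have "exp t *\<^sub>R (cross3 (partial 1 w ?x) (partial 2 \<phi> ?x) + cross3 (partial 1 \<phi> ?x) (partial 2 w ?x))
     = cross3 (cos \<theta> *\<^sub>R partial 1 w ?x + sin \<theta> *\<^sub>R partial 2 w ?x) (cyl_s \<phi> t \<theta>)
     + cross3 (cos \<theta> *\<^sub>R partial 1 \<phi> ?x + sin \<theta> *\<^sub>R partial 2 \<phi> ?x) (cyl_s w t \<theta>)"
    by (subst cross3_polar[symmetric, of "cos \<theta>" "sin \<theta>"]) (simp_all add: cyl_s_def scaleR_diff_right)
  finally show ?thesis unfolding cyl_t_def cross_mult_left scaleR_add_right[symmetric] .
qed

lemma W_cylinder:
  assumes "m \<ge> 1"
  shows "W m (polar (exp t) \<theta>) = rot m \<theta> (1 / cosh (real m * t)) 0 (tanh (real m * t))"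
proof -
  define e where "e = exp (real m * t)"
  have em: "exp t ^ m = e" by (simp add: e_def exp_of_nat_mult)
  have e2: "exp t ^ (2 * m) = e\<^sup>2" by (metis em power_mult mult.commute)
  have e: "e > 0" by (simp add: e_def)
  have "e\<^sup>2 + 1 > 0" by (simp add: add_nonneg_pos)
  then have "cosh (real m * t) = (e\<^sup>2 + 1) / (2 * e)" "sinh (real m * t) = (e\<^sup>2 - 1) / (2 * e)"
    using e by (simp_all add: cosh_field_def sinh_field_def exp_minus flip: e_def) (simp_all add: field_simps power2_eq_square)
  with e \<open>e\<^sup>2 + 1 > 0\<close> show ?thesis
    by (simp add: W_at_polar[OF assms] W_polar_def rot_def tanh_def em e2 vec_eq_iff forall_3)
qed

section \<open>Bounded solutions of the mode equations\<close>

lemma exp_growth_nonpos: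
  fixes x :: real
  assumes le: "\<And>s. s \<ge> 0 \<Longrightarrow> x * exp (p * s) \<le> B * exp (q * s)" and "q < p"
  shows "x \<le> 0"
proof (rule tendsto_lowerbound)
  have "filterlim (\<lambda>s. (q - p) * s) at_bot at_top"
    using assms(2) by (intro filterlim_tendsto_neg_mult_at_bot[OF tendsto_const _ filterlim_ident]) simp
  from tendsto_mult_right_zero[OF filterlim_compose[OF exp_at_bot this], of B]
  show "((\<lambda>s. B * exp ((q - p) * s)) \<longlongrightarrow> 0) at_top" .
  show "\<forall>\<^sub>F s in at_top. x \<le> B * exp ((q - p) * s)"
    using eventually_ge_at_top[of 0]
  proof eventually_elim
    case (elim s)
    have "x * exp (p * s) * exp (- (p * s)) \<le> B * exp (q * s) * exp (- (p * s))"
      using le[OF elim] by (intro mult_right_mono) auto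
    then show ?case by (simp add: mult.assoc algebra_simps flip: exp_add)
  qed
qed simp

text \<open>If \<open>c \<noteq> 0\<close>, the derivative grows like \<open>exp (2 (\<kappa> + \<mu>) t)\<close>, so \<open>Y\<close> cannot stay below a
  multiple of \<open>exp ((\<kappa> + \<mu>) t)\<close>. To see this, pair \<open>Y\<close> with \<open>c\<close> and compare with an exponential.\<close>

lemma slow_growth_forces_zero:
  fixes Y :: "real \<Rightarrow> complex"
  assumes Y: "\<And>t. (Y has_vector_derivative (exp (2 * \<kappa> * t) * (cosh (\<mu> * t))\<^sup>2) *\<^sub>R c) (at t)"
    and bound: "\<And>t. norm (Y t) \<le> B * (exp (\<kappa> * t) * cosh (\<mu> * t))"
    and pos: "\<kappa> \<ge> 0" "\<mu> > 0"
  shows "c = 0"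
proof -
  define n where "n = \<kappa> + \<mu>"
  have n: "n > 0" using pos by (simp add: n_def)
  \<comment> \<open>The factor \<open>8 n\<close> is \<open>4\<close> from \<open>cosh\<^sup>2 (\<mu> t) \<ge> exp (2 \<mu> t) / 4\<close> times \<open>2 n\<close> from integrating \<open>exp (2 n t)\<close>.\<close>
  define \<epsilon> where "\<epsilon> = (norm c)\<^sup>2 / (8 * n)"
  have B: "B \<ge> 0" using bound[of 0] norm_ge_zero[of "Y 0"] by (simp del: norm_ge_zero)
  define D where "D = (\<lambda>t. (c \<bullet> Y t) - \<epsilon> * exp (2 * n * t))"
  have D: "(D has_real_derivative ((norm c)\<^sup>2 * (exp (2 * \<kappa> * t) * (cosh (\<mu> * t))\<^sup>2) - \<epsilon> * (2 * n * exp (2 * n * t)))) (at t)" for t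
    unfolding D_def
  proof (intro DERIV_diff DERIV_cmult)
    have "((\<lambda>t. c \<bullet> Y t) has_vector_derivative (c \<bullet> ((exp (2 * \<kappa> * t) * (cosh (\<mu> * t))\<^sup>2) *\<^sub>R c))) (at t)"
      by (rule bounded_linear.has_vector_derivative[OF bounded_linear_inner_right Y])
    then show "((\<lambda>t. c \<bullet> Y t) has_real_derivative (norm c)\<^sup>2 * (exp (2 * \<kappa> * t) * (cosh (\<mu> * t))\<^sup>2)) (at t)"
      by (simp add: has_real_derivative_iff_has_vector_derivative power2_norm_eq_inner mult_ac)
    show "((\<lambda>t. exp (2 * n * t)) has_real_derivative 2 * n * exp (2 * n * t)) (at t)"
      by (auto intro!: derivative_eq_intros)
  qed
  have D': "\<epsilon> * (2 * n * exp (2 * n * t)) \<le> (norm c)\<^sup>2 * (exp (2 * \<kappa> * t) * (cosh (\<mu> * t))\<^sup>2)" for t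
  proof -
    have "exp (\<mu> * t) / 2 \<le> cosh (\<mu> * t)" by (simp add: cosh_field_def)
    then have "(exp (\<mu> * t) / 2)\<^sup>2 \<le> (cosh (\<mu> * t))\<^sup>2" by (intro power_mono) auto
    then have "(norm c)\<^sup>2 * (exp (2 * \<kappa> * t) * (exp (\<mu> * t) / 2)\<^sup>2) \<le> (norm c)\<^sup>2 * (exp (2 * \<kappa> * t) * (cosh (\<mu> * t))\<^sup>2)"
      by (intro mult_left_mono) auto
    moreover have "exp (2 * \<kappa> * t) * (exp (\<mu> * t))\<^sup>2 = exp (2 * n * t)"
      by (simp add: n_def algebra_simps power2_eq_square flip: exp_add)
    ultimately show ?thesis using n
      by (simp add: \<epsilon>_def power_divide field_simps)
  qed
  have "\<epsilon> * exp (2 * n * s) \<le> (2 * norm c * B + \<epsilon>) * exp (n * s)" if "s \<ge> 0" for s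
  proof -
    have "D 0 \<le> D s"
      using D D' by (intro DERIV_nonneg_imp_nondecreasing[OF that]) (metis diff_ge_0_iff_ge)
    then have "\<epsilon> * exp (2 * n * s) \<le> c \<bullet> Y s - c \<bullet> Y 0 + \<epsilon>" by (simp add: D_def)
    moreover have "\<bar>c \<bullet> Y s\<bar> \<le> norm c * norm (Y s)" "\<bar>c \<bullet> Y 0\<bar> \<le> norm c * norm (Y 0)"
      by (rule Cauchy_Schwarz_ineq2)+
    moreover have "norm (Y s) \<le> B * exp (n * s)"
    proof -
      have "cosh (\<mu> * s) \<le> exp (\<mu> * s)" using that pos by (simp add: cosh_field_def)
      then have "exp (\<kappa> * s) * cosh (\<mu> * s) \<le> exp (\<kappa> * s) * exp (\<mu> * s)" by simp
      also have "\<dots> = exp (n * s)" by (simp add: n_def algebra_simps flip: exp_add)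
      finally show ?thesis using bound[of s] B by (meson mult_left_mono order_trans)
    qed
    then have "norm c * norm (Y s) \<le> norm c * (B * exp (n * s))" by (simp add: mult_left_mono)
    moreover have "norm c * norm (Y 0) \<le> norm c * B" using bound[of 0] by (simp add: mult_left_mono)
    ultimately have "\<epsilon> * exp (2 * n * s) \<le> norm c * (B * exp (n * s)) + (norm c * B + \<epsilon>) * 1"
      unfolding mult_1_right by linarith
    also have "(norm c * B + \<epsilon>) * 1 \<le> (norm c * B + \<epsilon>) * exp (n * s)"
      using B n that by (intro mult_left_mono) (auto simp: \<epsilon>_def)
    finally show ?thesis by (simp add: algebra_simps)
  qed
  from exp_growth_nonpos[OF this] n have "\<epsilon> \<le> 0" by simp
  with n show ?thesis by (simp add: \<epsilon>_def divide_le_0_iff)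
qed

text \<open>The equation factors: \<open>y1 - k y\<close> solves a first-order equation with integrating factor
  \<open>exp (k t) / cosh\<^sup>2 (\<mu> t)\<close>, so it is \<open>c exp (- k t) cosh\<^sup>2 (\<mu> t)\<close>, and then
  \<open>Y = exp (- k t) y\<close> has derivative \<open>c exp (- 2 k t) cosh\<^sup>2 (\<mu> t)\<close>. The bound on \<open>y\<close> excludes \<open>c \<noteq> 0\<close>, at the
  end \<open>t \<rightarrow> \<infinity>\<close> if \<open>k \<le> 0\<close> and, after reflection, at the end \<open>t \<rightarrow> - \<infinity>\<close> if \<open>k > 0\<close>.\<close>

lemma tangential_mode_solution:
  fixes y :: "real \<Rightarrow> complex"
  assumes y: "\<And>t. (y has_vector_derivative y1 t) (at t)"
    and y1: "\<And>t. (y1 has_vector_derivative y2 t) (at t)"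
    and ode: "\<And>t. y2 t - k\<^sup>2 *\<^sub>R y t = (2 * \<mu> * tanh (\<mu> * t)) *\<^sub>R (y1 t - k *\<^sub>R y t)"
    and bound: "\<And>t. norm (y t) \<le> B * cosh (\<mu> * t)" and \<mu>: "\<mu> > 0"
  shows "\<exists>C. (\<forall>t. y t = C * of_real (exp (k * t))) \<and> (C = 0 \<or> \<bar>k\<bar> \<le> \<mu>)"
proof -
  define e where "e = (\<lambda>t. exp (k * t) / (cosh (\<mu> * t))\<^sup>2)"
  have e: "(e has_real_derivative e t * (k - 2 * \<mu> * tanh (\<mu> * t))) (at t)" for t
    unfolding e_def
    by (rule derivative_eq_intros refl | simp)+
       (simp add: tanh_def divide_simps, simp add: algebra_simps power2_eq_square power4_eq_xxxx)
  have "((\<lambda>t. e t *\<^sub>R (y1 t - k *\<^sub>R y t)) has_vector_derivative 0) (at t)" for t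
  proof -
    have "((\<lambda>t. e t *\<^sub>R (y1 t - k *\<^sub>R y t)) has_vector_derivative
        (e t *\<^sub>R (y2 t - k *\<^sub>R y1 t) + (e t * (k - 2 * \<mu> * tanh (\<mu> * t))) *\<^sub>R (y1 t - k *\<^sub>R y t))) (at t)"
      by (intro has_vector_derivative_scaleR e has_vector_derivative_diff y1
          bounded_linear.has_vector_derivative[OF bounded_linear_scaleR_right] y)
    moreover have "e t *\<^sub>R (y2 t - k *\<^sub>R y1 t) + (e t * (k - 2 * \<mu> * tanh (\<mu> * t))) *\<^sub>R (y1 t - k *\<^sub>R y t)
      = e t *\<^sub>R ((y2 t - k\<^sup>2 *\<^sub>R y t) - (2 * \<mu> * tanh (\<mu> * t)) *\<^sub>R (y1 t - k *\<^sub>R y t))"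
      by (simp add: algebra_simps power2_eq_square)
    ultimately show ?thesis by (simp add: ode)
  qed
  then obtain c where c: "\<And>t. e t *\<^sub>R (y1 t - k *\<^sub>R y t) = c"
    using has_vector_derivative_zero_constant[of UNIV "\<lambda>t. e t *\<^sub>R (y1 t - k *\<^sub>R y t)"] by auto
  have w: "y1 t - k *\<^sub>R y t = (exp (- (k * t)) * (cosh (\<mu> * t))\<^sup>2) *\<^sub>R c" for t
    by (simp flip: c[of t] add: e_def exp_minus)
  define Y where "Y = (\<lambda>t. exp (- (k * t)) *\<^sub>R y t)"
  have Y: "(Y has_vector_derivative (exp (2 * (- k) * t) * (cosh (\<mu> * t))\<^sup>2) *\<^sub>R c) (at t)" for t
  proof -
    have "(Y has_vector_derivative (exp (- (k * t)) *\<^sub>R y1 t + (- k * exp (- (k * t))) *\<^sub>R y t)) (at t)"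
      unfolding Y_def by (intro has_vector_derivative_scaleR y) (auto intro!: derivative_eq_intros)
    moreover have "exp (- (k * t)) *\<^sub>R y1 t + (- k * exp (- (k * t))) *\<^sub>R y t = exp (- (k * t)) *\<^sub>R (y1 t - k *\<^sub>R y t)"
      by (simp add: algebra_simps)
    moreover have "exp (- (k * t)) * exp (- (k * t)) = exp (2 * (- k) * t)" by (simp flip: exp_add)
    ultimately show ?thesis by (simp add: w flip: mult.assoc)
  qed
  have Yb: "norm (Y t) \<le> B * (exp (- k * t) * cosh (\<mu> * t))" for t
    using mult_left_mono[OF bound[of t], of "exp (- (k * t))"] by (simp add: Y_def mult_ac)
  have "c = 0"
  proof (cases "k \<le> 0")
    case True
    with slow_growth_forces_zero[of Y "- k", OF Y Yb] \<mu> show ?thesis by simp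
  next
    case False
    have "((\<lambda>t. - Y (- t)) has_vector_derivative (exp (2 * k * t) * (cosh (\<mu> * t))\<^sup>2) *\<^sub>R c) (at t)" for t
    proof -
      have "((Y \<circ> uminus) has_vector_derivative (- 1) *\<^sub>R ((exp (2 * (- k) * (- t)) * (cosh (\<mu> * (- t)))\<^sup>2) *\<^sub>R c)) (at t)"
        by (rule vector_diff_chain_at[OF _ Y]) (auto intro!: derivative_eq_intros)
      from has_vector_derivative_minus[OF this] show ?thesis by (simp add: o_def)
    qed
    from slow_growth_forces_zero[of "\<lambda>t. - Y (- t)" k, OF this, of B] Yb[of "- t" for t] False \<mu>
    show ?thesis by simp
  qed
  with Y have "\<And>t. (Y has_vector_derivative 0) (at t)" by simp
  then obtain C where C: "\<And>t. Y t = C"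
    using has_vector_derivative_zero_constant[of UNIV Y] by auto
  have yC: "y t = C * of_real (exp (k * t))" for t
    by (simp flip: C[of t] add: Y_def exp_minus scaleR_conv_of_real)
  have "C = 0" if "\<mu> < \<bar>k\<bar>"
  proof -
    have "norm C * exp (\<bar>k\<bar> * s) \<le> B * exp (\<mu> * s)" if "s \<ge> 0" for s
    proof -
      have B: "B \<ge> 0" using bound[of 0] norm_ge_zero[of "y 0"] by (simp del: norm_ge_zero)
      have "norm C * exp (\<bar>k\<bar> * s) = norm (y (sgn k * s))"
        by (simp add: yC norm_mult abs_sgn mult_ac)
      also have "\<dots> \<le> B * cosh (\<mu> * (sgn k * s))" by (rule bound)
      also have "cosh (\<mu> * (sgn k * s)) \<le> cosh (\<mu> * s)"
        by (cases k "0::real" rule: linorder_cases) (auto simp: cosh_real_ge_1)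
      also have "cosh (\<mu> * s) \<le> exp (\<mu> * s)" using \<open>s \<ge> 0\<close> \<mu> by (simp add: cosh_field_def)
      finally show ?thesis using B by (simp add: mult_left_mono)
    qed
    from exp_growth_nonpos[OF this that] show ?thesis by simp
  qed
  with yC show ?thesis by (intro exI[of _ C]) force
qed

lemma deriv_zero_imp_constant:
  fixes f :: "real \<Rightarrow> real"
  assumes "\<And>t. (f has_real_derivative 0) (at t)"
  shows "\<exists>c. \<forall>t. f t = c"
  using DERIV_isconst_all[of f _ 0] assms by blast

text \<open>The function \<open>h = exp (\<kappa> t) (\<kappa> - \<mu> tanh (\<mu> t))\<close> solves the same equation, and its Wronskian with \<open>y\<close> is
  constant. At \<open>- \<infinity>\<close> it tends to zero, because \<open>y1\<close> and the derivative of \<open>h\<close> do, and \<open>y\<close> and \<open>h\<close> are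
  bounded there. So \<open>y\<close> is a multiple of \<open>h\<close>. At \<open>+ \<infinity>\<close>, \<open>h\<close> grows like \<open>(\<kappa> - \<mu>) exp (\<kappa> t)\<close>, which is bounded only
  if \<open>\<kappa> = 0\<close> or \<open>\<kappa> = \<mu>\<close>.\<close>

lemma normal_mode_solution:
  fixes y :: "real \<Rightarrow> real"
  assumes y: "\<And>t. (y has_real_derivative y1 t) (at t)"
    and y1: "\<And>t. (y1 has_real_derivative (\<kappa>\<^sup>2 - 2 * \<mu>\<^sup>2 / (cosh (\<mu> * t))\<^sup>2) * y t) (at t)"
    and bound: "\<And>t. \<bar>y t\<bar> \<le> B" and lim: "(y1 \<longlongrightarrow> 0) at_bot"
    and pos: "\<kappa> \<ge> 0" "\<mu> > 0"
  shows "\<exists>C. (\<forall>t. y t = C * (exp (\<kappa> * t) * (\<kappa> - \<mu> * tanh (\<mu> * t)))) \<and> (C = 0 \<or> \<kappa> = 0 \<or> \<kappa> = \<mu>)"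
proof -
  define T where "T = (\<lambda>t. tanh (\<mu> * t))"
  define R where "R = (\<lambda>t. 1 / (cosh (\<mu> * t))\<^sup>2)"
  have T: "(T has_real_derivative \<mu> * R t) (at t)" for t
    unfolding T_def R_def
    by (auto intro!: derivative_eq_intros simp: tanh_def field_simps power2_eq_square hyperbolic_pythagoras[unfolded power2_eq_square] cosh_square_eq[unfolded power2_eq_square])
  have R: "(R has_real_derivative - 2 * \<mu> * R t * T t) (at t)" for t
    unfolding T_def R_def
    by (auto intro!: derivative_eq_intros simp: tanh_def field_simps power2_eq_square)
  define h where "h = (\<lambda>t. exp (\<kappa> * t) * (\<kappa> - \<mu> * T t))"
  define h1 where "h1 = (\<lambda>t. exp (\<kappa> * t) * (\<kappa> * (\<kappa> - \<mu> * T t) - \<mu>\<^sup>2 * R t))"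
  define q where "q = (\<lambda>t. \<kappa>\<^sup>2 - 2 * \<mu>\<^sup>2 * R t)"
  have h: "(h has_real_derivative h1 t) (at t)" for t
    unfolding h_def h1_def
    by (auto intro!: derivative_eq_intros T simp: algebra_simps power2_eq_square)
  have h1: "(h1 has_real_derivative q t * h t) (at t)" for t
    unfolding h_def h1_def q_def
    by (auto intro!: derivative_eq_intros T R simp: algebra_simps power2_eq_square)
  have y1': "(y1 has_real_derivative q t * y t) (at t)" for t
    using y1[of t] by (simp add: q_def R_def)
  have "((\<lambda>t. y1 t * h t - y t * h1 t) has_real_derivative 0) (at t)" for t
    by (rule derivative_eq_intros y y1' h h1 refl)+ (simp add: algebra_simps)
  from deriv_zero_imp_constant[OF this]
  obtain w where w: "\<And>t. y1 t * h t - y t * h1 t = w" by blast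
  have mt: "filterlim (\<lambda>t. \<mu> * t) at_bot at_bot"
    using pos by (intro filterlim_tendsto_pos_mult_at_bot[OF tendsto_const _ filterlim_ident])
  have Tlim: "(T \<longlongrightarrow> - 1) at_bot"
    unfolding T_def by (rule filterlim_compose[OF tanh_real_at_bot mt])
  have "R = (\<lambda>t. 1 - (T t)\<^sup>2)"
  proof
    show "R t = 1 - (T t)\<^sup>2" for t
      using hyperbolic_pythagoras[of "\<mu> * t"] by (simp add: R_def T_def tanh_def divide_simps)
  qed
  with Tlim have Rlim: "(R \<longlongrightarrow> 0) at_bot" by (auto intro!: tendsto_eq_intros)
  \<comment> \<open>The limit \<open>l\<close> is \<open>1\<close> for \<open>\<kappa> = 0\<close> and \<open>0\<close> otherwise; \<open>l \<kappa> = 0\<close> is what both cases share.\<close>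
  have elim: "\<exists>l. ((\<lambda>t. exp (\<kappa> * t)) \<longlongrightarrow> l) at_bot \<and> l * \<kappa> = 0"
  proof (cases "\<kappa> = 0")
    case False
    with pos have "filterlim (\<lambda>t. \<kappa> * t) at_bot at_bot"
      by (intro filterlim_tendsto_pos_mult_at_bot[OF tendsto_const _ filterlim_ident]) auto
    from filterlim_compose[OF exp_at_bot this] show ?thesis by auto
  qed auto
  then obtain l where l: "((\<lambda>t. exp (\<kappa> * t)) \<longlongrightarrow> l) at_bot" "l * \<kappa> = 0" by blast
  have "(h \<longlongrightarrow> l * (\<kappa> - \<mu> * (- 1))) at_bot" unfolding h_def by (intro tendsto_intros l Tlim)
  with lim have "((\<lambda>t. y1 t * h t) \<longlongrightarrow> 0) at_bot" by (auto intro!: tendsto_eq_intros)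
  moreover have "((\<lambda>t. y t * h1 t) \<longlongrightarrow> 0) at_bot"
  proof (rule Lim_null_comparison[OF always_eventually])
    show "\<forall>t. norm (y t * h1 t) \<le> B * \<bar>h1 t\<bar>" using bound by (simp add: abs_mult mult_right_mono)
    have "(h1 \<longlongrightarrow> l * (\<kappa> * (\<kappa> - \<mu> * (- 1)) - \<mu>\<^sup>2 * 0)) at_bot"
      unfolding h1_def by (intro tendsto_intros l Tlim Rlim)
    also have "l * (\<kappa> * (\<kappa> - \<mu> * (- 1)) - \<mu>\<^sup>2 * 0) = 0" using l by auto
    finally show "((\<lambda>t. B * \<bar>h1 t\<bar>) \<longlongrightarrow> 0) at_bot"
      by (intro tendsto_mult_right_zero tendsto_rabs_zero)
  qed
  ultimately have "((\<lambda>t. y1 t * h t - y t * h1 t) \<longlongrightarrow> 0) at_bot" by (auto intro: tendsto_eq_intros)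
  then have "((\<lambda>t::real. w) \<longlongrightarrow> 0) at_bot" unfolding w .
  then have "w = 0" by (simp add: tendsto_const_iff)
  with w have W0: "y1 t * h t = y t * h1 t" for t by simp
  have nz: "(h t)\<^sup>2 + (h1 t)\<^sup>2 \<noteq> 0" for t
  proof
    assume "(h t)\<^sup>2 + (h1 t)\<^sup>2 = 0"
    then have "h t = 0" "h1 t = 0" by (auto simp: sum_power2_eq_zero_iff)
    then show False using pos by (simp add: h_def h1_def R_def)
  qed
  \<comment> \<open>The ratio of the parallel vectors \<open>(y, y1)\<close> and \<open>(h, h1)\<close>, written as a projection since \<open>h\<close> has a zero when \<open>\<kappa> < \<mu>\<close>.\<close>
  define c where "c = (\<lambda>t. (y t * h t + y1 t * h1 t) / ((h t)\<^sup>2 + (h1 t)\<^sup>2))"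
  have yc: "y t = c t * h t" for t
  proof -
    have "(y t * h t + y1 t * h1 t) * h t = y t * ((h t)\<^sup>2 + (h1 t)\<^sup>2)"
      using W0[of t] by (simp add: power2_eq_square algebra_simps)
    with nz[of t] show ?thesis by (simp add: c_def field_simps)
  qed
  have y1c: "y1 t = c t * h1 t" for t
  proof -
    have "(y t * h t + y1 t * h1 t) * h1 t = y1 t * ((h t)\<^sup>2 + (h1 t)\<^sup>2)"
      using W0[of t] by (simp add: power2_eq_square algebra_simps)
    with nz[of t] show ?thesis by (simp add: c_def field_simps)
  qed
  have "(c has_real_derivative 0) (at t)" for t
  proof -
    have "\<exists>d. (c has_real_derivative d) (at t)"
      unfolding c_def by (intro exI) (rule derivative_intros y y1' h h1 nz)+
    then obtain d where d: "(c has_real_derivative d) (at t)" by blast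
    have "((\<lambda>t. c t * h t) has_real_derivative d * h t + h1 t * c t) (at t)"
      by (rule DERIV_mult[OF d h])
    with y[of t] have "y1 t = d * h t + h1 t * c t"
      using yc by (metis (no_types, lifting) DERIV_unique ext)
    then have "d * h t = 0" by (simp add: y1c)
    moreover have "((\<lambda>t. c t * h1 t) has_real_derivative d * h1 t + q t * h t * c t) (at t)"
      by (rule DERIV_mult[OF d h1])
    with y1'[of t] have "q t * y t = d * h1 t + q t * h t * c t"
      using y1c by (metis (no_types, lifting) DERIV_unique ext)
    then have "d * h1 t = 0" by (simp add: yc)
    ultimately have "d = 0" using nz[of t] by auto
    with d show ?thesis by simp
  qed
  from deriv_zero_imp_constant[OF this] obtain C where C: "\<And>t. c t = C" by blast
  have "C = 0" if "\<kappa> \<noteq> 0" "\<kappa> \<noteq> \<mu>"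
  proof -
    have top: "filterlim (\<lambda>t. \<mu> * t) at_top at_top"
      using pos by (intro filterlim_tendsto_pos_mult_at_top[OF tendsto_const _ filterlim_ident])
    have bot: "filterlim (\<lambda>t. - \<kappa> * t) at_bot at_top"
      using pos that by (intro filterlim_tendsto_neg_mult_at_bot[OF tendsto_const _ filterlim_ident]) auto
    have "((\<lambda>t. C * (\<kappa> - \<mu> * T t)) \<longlongrightarrow> C * (\<kappa> - \<mu> * 1)) at_top"
      unfolding T_def by (intro tendsto_intros filterlim_compose[OF tanh_real_at_top top])
    moreover have "((\<lambda>t. C * (\<kappa> - \<mu> * T t)) \<longlongrightarrow> 0) at_top"
    proof (rule Lim_null_comparison[OF always_eventually])
      have "\<bar>y t\<bar> * exp (- \<kappa> * t) \<le> B * exp (- \<kappa> * t)" for t using bound by (intro mult_right_mono) auto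
      moreover have "\<bar>y t\<bar> * exp (- \<kappa> * t) = \<bar>C * (\<kappa> - \<mu> * T t)\<bar>" for t
        by (simp add: yc C h_def abs_mult exp_minus)
      ultimately show "\<forall>t. norm (C * (\<kappa> - \<mu> * T t)) \<le> B * exp (- \<kappa> * t)"
        unfolding real_norm_def by metis
      show "((\<lambda>t. B * exp (- \<kappa> * t)) \<longlongrightarrow> 0) at_top"
        by (intro tendsto_mult_right_zero filterlim_compose[OF exp_at_bot bot])
    qed
    ultimately have "C * (\<kappa> - \<mu> * 1) = 0" by (rule tendsto_unique[rotated]) simp
    with that show ?thesis by simp
  qed
  with yc C show ?thesis unfolding h_def T_def by (intro exI[of _ C]) metis
qed

section \<open>The linearized equation in the moving frame\<close>

text \<open>Pairing the linearized equation with a vector field \<open>N\<close>: the left-hand side is the Laplacian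
  of \<open>X \<bullet> N\<close>, and in the cross product terms the derivatives of \<open>X\<close> are isolated by the triple product
  identity. What remains is determined by the three vectors \<open>P\<close>, \<open>Q\<close>, \<open>R\<close>, which depend on \<open>N\<close> and \<open>W\<close>
  only.\<close>

lemma projected_equation:
  fixes X Xt Xs Xtt Xss N Nt Ns Ntt Nss Wt Ws P Q R :: "real^3"
  assumes eq: "Xtt + Xss = 2 *\<^sub>R (cross3 Wt Xs + cross3 Xt Ws)"
    and P: "cross3 N Wt + Ns = P" and Q: "cross3 Ws N + Nt = Q" and R: "Ntt + Nss = R"
  shows "((X \<bullet> Ntt + Xt \<bullet> Nt) + (Xt \<bullet> Nt + Xtt \<bullet> N)) + ((X \<bullet> Nss + Xs \<bullet> Ns) + (Xs \<bullet> Ns + Xss \<bullet> N))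
     = X \<bullet> R + 2 * (Xt \<bullet> Q) + 2 * (Xs \<bullet> P)"
proof -
  have "(cross3 Wt Xs + cross3 Xt Ws) \<bullet> N = Xs \<bullet> cross3 N Wt + Xt \<bullet> cross3 Ws N"
    by (simp add: inner_vec_def sum_3 cross3_def algebra_simps)
  then have "Xtt \<bullet> N + Xss \<bullet> N = 2 * (Xs \<bullet> cross3 N Wt + Xt \<bullet> cross3 Ws N)"
    by (simp add: eq flip: inner_add_left)
  then show ?thesis
    by (simp add: inner_add_right flip: P Q R)
qed

lemma rot_cong: "a = a' \<Longrightarrow> c = c' \<Longrightarrow> b = b' \<Longrightarrow> rot m \<theta> a c b = rot m \<theta> a' c' b'"
  by simp

lemma rot_zero: "rot m \<theta> 0 0 0 = 0"
  by (simp add: rot_def vec_eq_iff forall_3)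

lemma exp_times_one_minus_tanh: "exp x * (1 - tanh x) = 1 / cosh (x :: real)"
proof -
  have "exp x * (cosh x - sinh x) = 1" by (simp add: cosh_minus_sinh flip: exp_add)
  then show ?thesis by (simp add: tanh_def field_simps)
qed

lemma cylinder_C2_zero: "cylinder_C2 (\<lambda>t \<theta>. 0) (\<lambda>t \<theta>. 0) (\<lambda>t \<theta>. 0) (\<lambda>t \<theta>. 0) (\<lambda>t \<theta>. 0)"
  by (simp add: cylinder_C2_def)

lemma has_real_derivative_Re_Im:
  assumes "(y has_vector_derivative y') (at t)"
  shows "((\<lambda>t. Re (y t)) has_real_derivative Re y') (at t)"
    "((\<lambda>t. Im (y t)) has_real_derivative Im y') (at t)"
  using bounded_linear.has_vector_derivative[OF bounded_linear_Re assms]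
    bounded_linear.has_vector_derivative[OF bounded_linear_Im assms]
  by (simp_all add: has_real_derivative_iff_has_vector_derivative)

text \<open>The general linear combination of the \<open>4 m + 5\<close> kernel functions.\<close>

definition kernel_combination where
  "kernel_combination m a b c \<alpha> \<beta> \<gamma> \<delta> r \<theta> =
            a *\<^sub>R (((r ^ (2 * m) - 1) / (r ^ (2 * m) + 1)) *\<^sub>R W_polar m r \<theta>)
          + b *\<^sub>R ((r ^ m / (1 + r ^ (2 * m)) * cos (real m * \<theta>)) *\<^sub>R W_polar m r \<theta>)
          + c *\<^sub>R ((r ^ m / (1 + r ^ (2 * m)) * sin (real m * \<theta>)) *\<^sub>R W_polar m r \<theta>)
          + (\<Sum>k=0..m.
                \<alpha> k *\<^sub>R ((r ^ (m - k) / (1 + r ^ (2 * m))) *\<^sub>R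
                  (cos (real k * \<theta>) *\<^sub>R E1 m r \<theta> + sin (real k * \<theta>) *\<^sub>R E2 m r \<theta>))
              + \<beta> k *\<^sub>R ((r ^ (m - k) / (1 + r ^ (2 * m))) *\<^sub>R
                  (sin (real k * \<theta>) *\<^sub>R E1 m r \<theta> - cos (real k * \<theta>) *\<^sub>R E2 m r \<theta>)))
          + (\<Sum>l=1..m.
                \<gamma> l *\<^sub>R ((r ^ (m + l) / (1 + r ^ (2 * m))) *\<^sub>R
                  (cos (real l * \<theta>) *\<^sub>R E1 m r \<theta> - sin (real l * \<theta>) *\<^sub>R E2 m r \<theta>))
              + \<delta> l *\<^sub>R ((r ^ (m + l) / (1 + r ^ (2 * m))) *\<^sub>R
                  (sin (real l * \<theta>) *\<^sub>R E1 m r \<theta> + cos (real l * \<theta>) *\<^sub>R E2 m r \<theta>)))"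

lemma even_power_plus_one_pos: "r ^ (2 * m) + 1 > (0::real)"
  by (simp add: power_mult add_nonneg_pos)

lemma continuous_on_kernel_combination:
  "continuous_on A (\<lambda>r. kernel_combination m a b c \<alpha> \<beta> \<gamma> \<delta> r \<theta>)"
proof -
  have nz: "\<forall>r\<in>A. r ^ (2 * m) + 1 \<noteq> 0" "\<forall>r\<in>A. 1 + r ^ (2 * m) \<noteq> (0::real)"
    using even_power_plus_one_pos by (simp_all add: add.commute[of 1] less_imp_neq[symmetric])
  have "continuous_on A (\<lambda>r. W_polar m r \<theta>)" "continuous_on A (\<lambda>r. E1 m r \<theta>)" "continuous_on A (\<lambda>r. E2 m r \<theta>)"
    unfolding W_polar_def E1_def E2_def by (intro continuous_on_vector_3 continuous_intros nz)+
  then show ?thesis unfolding kernel_combination_def by (intro continuous_intros nz)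
qed

lemma sum_symmetric_int_interval:
  fixes f :: "int \<Rightarrow> 'a::comm_monoid_add"
  shows "(\<Sum>k\<in>{- int m..int m}. f k) = (\<Sum>k=0..m. f (- int k)) + (\<Sum>l=1..m. f (int l))"
proof -
  have "{- int m..int m} = {- int m..0} \<union> {1..int m}" by auto
  then have "(\<Sum>k\<in>{- int m..int m}. f k) = (\<Sum>k\<in>{- int m..0}. f k) + (\<Sum>k\<in>{1..int m}. f k)"
    by (simp add: sum.union_disjoint)
  moreover have "(\<Sum>k\<in>{- int m..0}. f k) = (\<Sum>k=0..m. f (- int k))"
    by (rule sum.reindex_bij_witness[of _ "\<lambda>k. - int k" "\<lambda>k. nat (- k)"]) auto
  moreover have "(\<Sum>k\<in>{1..int m}. f k) = (\<Sum>l=1..m. f (int l))"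
    by (rule sum.reindex_bij_witness[of _ int nat]) auto
  ultimately show ?thesis by simp
qed

text \<open>The profiles of \<open>W\<close> on the cylinder. The vectors \<open>frame_N1\<close> and \<open>frame_N2\<close> are \<open>- cosh (m t) E\<^sub>1\<close> and
  \<open>cosh (m t) E\<^sub>2\<close>, that is, \<open>W\<^sub>t\<close> and \<open>W\<^sub>\<theta>\<close> divided by \<open>m S\<^sup>2\<close>. With this scaling they are
  harmonic and conjugate to each other (\<open>N\<^sub>1\<^sub>t = N\<^sub>2\<^sub>\<theta>\<close> and \<open>N\<^sub>1\<^sub>\<theta> = - N\<^sub>2\<^sub>t\<close>), like the Cartesian components of a
  holomorphic function.\<close>

locale bubble =
  fixes m :: nat
  assumes m: "m \<ge> 1"
begin

definition S where "S t = 1 / cosh (real m * t)"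
definition T where "T t = tanh (real m * t)"
definition C where "C t = cosh (real m * t)"
definition Sh where "Sh t = sinh (real m * t)"

abbreviation frame_W where "frame_W t \<theta> \<equiv> rot m \<theta> (S t) 0 (T t)"
abbreviation frame_N1 where "frame_N1 t \<theta> \<equiv> rot m \<theta> (- Sh t) 0 1"
abbreviation frame_N2 where "frame_N2 t \<theta> \<equiv> rot m \<theta> 0 (C t) 0"

lemma profile_identities: "(S t)\<^sup>2 + (T t)\<^sup>2 = 1" "S t > 0" "T t = Sh t * S t" "C t * S t = 1" "(C t)\<^sup>2 - (Sh t)\<^sup>2 = 1" "C t > 0"
proof -
  have *: "(cosh (real m * t))\<^sup>2 = 1 + (sinh (real m * t))\<^sup>2" by (simp add: cosh_square_eq)
  show "(S t)\<^sup>2 + (T t)\<^sup>2 = 1"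
    by (simp add: S_def T_def tanh_def power_divide flip: add_divide_distrib *)
qed (simp_all add: S_def T_def C_def Sh_def tanh_def hyperbolic_pythagoras)

lemma profile_derivs: "(S has_real_derivative - (real m * S t * T t)) (at t)"
  "(T has_real_derivative real m * (S t)\<^sup>2) (at t)"
  "(C has_real_derivative real m * Sh t) (at t)" "(Sh has_real_derivative real m * C t) (at t)"
proof -
  show "(C has_real_derivative real m * Sh t) (at t)" "(Sh has_real_derivative real m * C t) (at t)"
    unfolding C_def Sh_def by (auto intro!: derivative_eq_intros)
  show "(S has_real_derivative - (real m * S t * T t)) (at t)"
    unfolding S_def T_def by (auto intro!: derivative_eq_intros simp: tanh_def)
  have "1 - (T t)\<^sup>2 = (S t)\<^sup>2" using profile_identities(1)[of t] by simp
  then show "(T has_real_derivative real m * (S t)\<^sup>2) (at t)"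
    unfolding T_def by (auto intro!: derivative_eq_intros)
qed

lemma W_eq: "W m (polar (exp t) \<theta>) = frame_W t \<theta>"
  by (simp add: W_cylinder[OF m] S_def T_def)

lemma W_C2: "C2 (W m)" using H_system_W[OF m] by (simp add: H_system_solution_def)

lemma cyl_t_W: "cyl_t (W m) t \<theta> = rot m \<theta> (- (real m * S t * T t)) 0 (real m * (S t)\<^sup>2)"
proof -
  have "((\<lambda>t. frame_W t \<theta>) has_vector_derivative cyl_t (W m) t \<theta>) (at t)"
    using cyl_derivative(1)[OF C2D(1)[OF W_C2], of \<theta> t] by (simp add: W_eq)
  moreover have "((\<lambda>t. frame_W t \<theta>) has_vector_derivative rot m \<theta> (- (real m * S t * T t)) 0 (real m * (S t)\<^sup>2)) (at t)"
    by (intro has_vector_derivative_rot_t profile_derivs DERIV_const)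
  ultimately show ?thesis by (rule vector_derivative_unique_at)
qed

lemma cyl_s_W: "cyl_s (W m) t \<theta> = rot m \<theta> 0 (real m * S t) 0"
proof -
  have "((\<lambda>\<theta>. frame_W t \<theta>) has_vector_derivative cyl_s (W m) t \<theta>) (at \<theta>)"
    using cyl_derivative(2)[OF C2D(1)[OF W_C2], of t \<theta>] by (simp add: W_eq)
  then show ?thesis
    using has_vector_derivative_rot_angle[of m "S t" 0 "T t" \<theta>] vector_derivative_unique_at by fastforce
qed

lemma continuous_profiles: "continuous_on UNIV S" "continuous_on UNIV T" "continuous_on UNIV C" "continuous_on UNIV Sh"
  using profile_derivs by (meson DERIV_isCont continuous_at_imp_continuous_on)+

lemma cylinder_C2_frame_W: "cylinder_C2 (\<lambda>t \<theta>. frame_W t \<theta>) (\<lambda>t \<theta>. rot m \<theta> (- (real m * S t * T t)) 0 (real m * (S t)\<^sup>2))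
   (\<lambda>t \<theta>. rot m \<theta> (real m * - 0) (real m * S t) 0)
   (\<lambda>t \<theta>. rot m \<theta> ((real m)\<^sup>2 * S t * ((T t)\<^sup>2 - (S t)\<^sup>2)) 0 (- 2 * (real m)\<^sup>2 * (S t)\<^sup>2 * T t))
   (\<lambda>t \<theta>. rot m \<theta> (real m * - (real m * S t)) (real m * (real m * - 0)) 0)"
proof (rule cylinder_C2_rot)
  show "((\<lambda>t. - (real m * S t * T t)) has_real_derivative (real m)\<^sup>2 * S t * ((T t)\<^sup>2 - (S t)\<^sup>2)) (at t)" for t
    by (rule derivative_eq_intros profile_derivs refl)+ (simp add: algebra_simps power2_eq_square)
  show "((\<lambda>t. real m * (S t)\<^sup>2) has_real_derivative - 2 * (real m)\<^sup>2 * (S t)\<^sup>2 * T t) (at t)" for t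
    by (rule derivative_eq_intros profile_derivs refl)+ (simp add: algebra_simps power2_eq_square)
qed (auto intro!: profile_derivs continuous_intros continuous_profiles)

lemma cylinder_C2_frame_N1: "cylinder_C2 (\<lambda>t \<theta>. frame_N1 t \<theta>) (\<lambda>t \<theta>. rot m \<theta> (- (real m * C t)) 0 0)
   (\<lambda>t \<theta>. rot m \<theta> (real m * - 0) (real m * - Sh t) 0)
   (\<lambda>t \<theta>. rot m \<theta> (- (real m * (real m * Sh t))) 0 0)
   (\<lambda>t \<theta>. rot m \<theta> (real m * - (real m * - Sh t)) (real m * (real m * - 0)) 0)"
  by (rule cylinder_C2_rot)
     (auto intro!: continuous_intros continuous_profiles DERIV_minus profile_derivs DERIV_cmult)

lemma cylinder_C2_frame_N2: "cylinder_C2 (\<lambda>t \<theta>. frame_N2 t \<theta>) (\<lambda>t \<theta>. rot m \<theta> 0 (real m * Sh t) 0)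
   (\<lambda>t \<theta>. rot m \<theta> (real m * - C t) (real m * 0) 0)
   (\<lambda>t \<theta>. rot m \<theta> 0 (real m * (real m * C t)) 0)
   (\<lambda>t \<theta>. rot m \<theta> (real m * - (real m * 0)) (real m * (real m * - C t)) 0)"
  by (rule cylinder_C2_rot)
     (auto intro!: continuous_intros continuous_profiles profile_derivs DERIV_cmult)

lemma S_le_exp: "t \<le> 0 \<Longrightarrow> S t \<le> 2 * exp t"
proof -
  assume t: "t \<le> 0"
  have "real m * t \<le> 1 * t" using m t by (intro mult_right_mono_neg) auto
  then have "exp (- t) \<le> exp (- (real m * t))" by simp
  also have "\<dots> \<le> 2 * C t" by (simp add: C_def cosh_field_def)
  finally have "exp (- t) * S t \<le> 2 * C t * S t" using profile_identities(2)[of t] by (intro mult_right_mono) auto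
  also have "\<dots> = 2" using profile_identities(4)[of t] by simp
  finally show ?thesis by (simp add: exp_minus field_simps)
qed

lemma S_T_radial:
  "S t = 2 * exp t ^ m / (1 + exp t ^ (2 * m))"
  "T t = (exp t ^ (2 * m) - 1) / (exp t ^ (2 * m) + 1)"
proof -
  have "W m (polar (exp t) 0) = W_polar m (exp t) 0" by (rule W_at_polar[OF m]) simp
  then have "rot m 0 (S t) 0 (T t) = W_polar m (exp t) 0" by (simp only: W_eq)
  then have "rot m 0 (S t) 0 (T t) $ 1 = W_polar m (exp t) 0 $ 1" "rot m 0 (S t) 0 (T t) $ 3 = W_polar m (exp t) 0 $ 3"
    by simp_all
  then show "S t = 2 * exp t ^ m / (1 + exp t ^ (2 * m))"
    "T t = (exp t ^ (2 * m) - 1) / (exp t ^ (2 * m) + 1)"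
    by (simp_all add: rot_def W_polar_def add.commute)
qed

lemma frame_radial:
  "W_polar m (exp t) \<theta> = frame_W t \<theta>"
  "E1 m (exp t) \<theta> = rot m \<theta> (T t) 0 (- S t)"
  "E2 m (exp t) \<theta> = rot m \<theta> 0 1 0"
  unfolding rot_def W_polar_def E1_def E2_def S_T_radial
  by (simp_all add: vec_eq_iff forall_3 add.commute)

context
  fixes \<phi> :: "real^2 \<Rightarrow> real^3" and B :: real
  assumes lin: "linearized_solution (W m) \<phi>" and bdd: "\<And>x. norm (\<phi> x) \<le> B"
begin

lemma C2_\<phi>: "C2 \<phi>" using lin by (simp add: linearized_solution_def)

lemma cylinder_C2_cyl: "cylinder_C2 (cyl \<phi>) (cyl_t \<phi>) (cyl_s \<phi>) (cyl_tt \<phi>) (cyl_ss \<phi>)"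
  using cylinder_C2_polar[OF C2_\<phi>] by (simp add: cyl_def[abs_def])

lemma cyl_equation_W: "cyl_tt \<phi> t \<theta> + cyl_ss \<phi> t \<theta>
   = 2 *\<^sub>R (cross3 (rot m \<theta> (- (real m * S t * T t)) 0 (real m * (S t)\<^sup>2)) (cyl_s \<phi> t \<theta>) + cross3 (cyl_t \<phi> t \<theta>) (rot m \<theta> 0 (real m * S t) 0))"
  using cyl_equation[OF lin] by (simp add: cyl_t_W cyl_s_W)

lemma norm_cyl_le: "norm (cyl \<phi> t \<theta>) \<le> B" by (simp add: cyl_def bdd)

text \<open>As \<open>t \<rightarrow> - \<infinity>\<close> the derivative in \<open>t\<close> decays, being \<open>r\<close> times the radial derivative of a function that is
  continuously differentiable at the origin.\<close>

lemma norm_cyl_t_le: "\<exists>M. \<forall>t\<le>0. \<forall>\<theta>. norm (cyl_t \<phi> t \<theta>) \<le> M * exp t"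
proof -
  have "\<exists>M. \<forall>x\<in>cball 0 1. norm (partial i \<phi> x) \<le> M" for i
    using compact_imp_bounded[OF compact_continuous_image[OF C2D(4)[OF C2_\<phi>] compact_cball]]
    unfolding bounded_iff by blast
  then obtain M where M: "\<And>i x. x \<in> cball 0 1 \<Longrightarrow> norm (partial i \<phi> x) \<le> M i" by metis
  have "norm (cyl_t \<phi> t \<theta>) \<le> (M 1 + M 2) * exp t" if "t \<le> 0" for t \<theta>
  proof -
    have "norm (polar (exp t) \<theta>) = exp t"
      by (simp add: polar_def norm_vec_def L2_set_def sum_2 power_mult_distrib flip: distrib_left)
    then have x: "polar (exp t) \<theta> \<in> cball 0 1" using that by simp
    have b: "norm (k *\<^sub>R partial i \<phi> (polar (exp t) \<theta>)) \<le> M i" if "\<bar>k\<bar> \<le> 1" for k i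
      using mult_mono[OF that M[OF x, of i]] by simp
    have "norm (cos \<theta> *\<^sub>R partial 1 \<phi> (polar (exp t) \<theta>) + sin \<theta> *\<^sub>R partial 2 \<phi> (polar (exp t) \<theta>)) \<le> M 1 + M 2"
      by (intro norm_triangle_mono b) auto
    then have "exp t * norm (cos \<theta> *\<^sub>R partial 1 \<phi> (polar (exp t) \<theta>) + sin \<theta> *\<^sub>R partial 2 \<phi> (polar (exp t) \<theta>)) \<le> exp t * (M 1 + M 2)"
      by (intro mult_left_mono) auto
    then show ?thesis by (simp add: cyl_t_def mult.commute)
  qed
  then show ?thesis by blast
qed

text \<open>Here \<open>N = W\<close>, and \<open>W \<times> W\<^sub>t + W\<^sub>\<theta> = 0\<close> and \<open>W\<^sub>\<theta> \<times> W + W\<^sub>t = 0\<close> remove the first derivatives of \<open>\<phi>\<close> from the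
  equation for \<open>g\<close>; what is left is \<open>\<phi> \<bullet> \<Delta>W = - 2 m\<^sup>2 S\<^sup>2 (\<phi> \<bullet> W)\<close>. The last fact controls the \<open>t\<close>-derivative
  at the end of the cylinder that corresponds to the origin.\<close>

lemma normal_equation:
  obtains gt gs gtt gss M where
    "cylinder_C2 (\<lambda>t \<theta>. cyl \<phi> t \<theta> \<bullet> frame_W t \<theta>) gt gs gtt gss"
    "\<And>t \<theta>. gtt t \<theta> + gss t \<theta> = - (2 * (real m)\<^sup>2 * (S t)\<^sup>2) * (cyl \<phi> t \<theta> \<bullet> frame_W t \<theta>)"
    "\<And>t \<theta>. t \<le> 0 \<Longrightarrow> \<bar>gt t \<theta>\<bar> \<le> M * exp t"
proof -
  obtain M where M: "\<And>t \<theta>. t \<le> 0 \<Longrightarrow> norm (cyl_t \<phi> t \<theta>) \<le> M * exp t"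
    using norm_cyl_t_le by blast
  show thesis
  proof (rule that[OF cylinder_C2_bilinear[OF bounded_bilinear_inner cylinder_C2_cyl cylinder_C2_frame_W]])
    show "\<bar>cyl \<phi> t \<theta> \<bullet> rot m \<theta> (- (real m * S t * T t)) 0 (real m * (S t)\<^sup>2) + cyl_t \<phi> t \<theta> \<bullet> frame_W t \<theta>\<bar>
       \<le> (B * (2 * real m) + M) * exp t" if "t \<le> 0" for t \<theta>
    proof -
      have "norm (frame_W t \<theta>) = 1" by (simp add: norm_rot profile_identities(1))
      moreover have "norm (rot m \<theta> (- (real m * S t * T t)) 0 (real m * (S t)\<^sup>2)) = real m * S t"
      proof -
        have "(- (real m * S t * T t))\<^sup>2 + 0\<^sup>2 + (real m * (S t)\<^sup>2)\<^sup>2 = (real m * S t)\<^sup>2 * ((S t)\<^sup>2 + (T t)\<^sup>2)"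
          by (simp add: power2_eq_square algebra_simps)
        then show ?thesis using profile_identities(2)[of t] by (simp add: norm_rot profile_identities(1))
      qed
      ultimately have "\<bar>cyl \<phi> t \<theta> \<bullet> rot m \<theta> (- (real m * S t * T t)) 0 (real m * (S t)\<^sup>2)\<bar> \<le> norm (cyl \<phi> t \<theta>) * (real m * S t)"
        "\<bar>cyl_t \<phi> t \<theta> \<bullet> frame_W t \<theta>\<bar> \<le> norm (cyl_t \<phi> t \<theta>) * 1"
        by (metis Cauchy_Schwarz_ineq2)+
      moreover have "norm (cyl \<phi> t \<theta>) * (real m * S t) \<le> B * (real m * (2 * exp t))"
        using norm_cyl_le[of t \<theta>] S_le_exp[OF that] profile_identities(2)[of t] order_trans[OF norm_ge_zero norm_cyl_le]
        by (intro mult_mono mult_left_mono) (auto simp: less_imp_le)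
      ultimately show ?thesis using M[OF that, of \<theta>] by (simp add: algebra_simps)
    qed
    show "((cyl \<phi> t \<theta> \<bullet> rot m \<theta> ((real m)\<^sup>2 * S t * ((T t)\<^sup>2 - (S t)\<^sup>2)) 0 (- 2 * (real m)\<^sup>2 * (S t)\<^sup>2 * T t) + cyl_t \<phi> t \<theta> \<bullet> rot m \<theta> (- (real m * S t * T t)) 0 (real m * (S t)\<^sup>2))
       + (cyl_t \<phi> t \<theta> \<bullet> rot m \<theta> (- (real m * S t * T t)) 0 (real m * (S t)\<^sup>2) + cyl_tt \<phi> t \<theta> \<bullet> frame_W t \<theta>))
       + ((cyl \<phi> t \<theta> \<bullet> rot m \<theta> (real m * - (real m * S t)) (real m * (real m * - 0)) 0 + cyl_s \<phi> t \<theta> \<bullet> rot m \<theta> (real m * - 0) (real m * S t) 0)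
       + (cyl_s \<phi> t \<theta> \<bullet> rot m \<theta> (real m * - 0) (real m * S t) 0 + cyl_ss \<phi> t \<theta> \<bullet> frame_W t \<theta>))
       = - (2 * (real m)\<^sup>2 * (S t)\<^sup>2) * (cyl \<phi> t \<theta> \<bullet> frame_W t \<theta>)" for t \<theta>
    proof -
      define k where "k = - (2 * (real m)\<^sup>2 * (S t)\<^sup>2)"
      show ?thesis
      proof (subst projected_equation[OF cyl_equation_W, where P = "rot m \<theta> 0 0 0" and Q = "rot m \<theta> 0 0 0" and R = "k *\<^sub>R frame_W t \<theta>"])
        show "cross3 (frame_W t \<theta>) (rot m \<theta> (- (real m * S t * T t)) 0 (real m * (S t)\<^sup>2))
          + rot m \<theta> (real m * - 0) (real m * S t) 0 = rot m \<theta> 0 0 0"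
          unfolding rot_cross rot_add by (rule rot_cong; insert profile_identities(1)[of t]; ((simp add: algebra_simps power2_eq_square; fail) | algebra))
        show "cross3 (rot m \<theta> 0 (real m * S t) 0) (frame_W t \<theta>)
          + rot m \<theta> (- (real m * S t * T t)) 0 (real m * (S t)\<^sup>2) = rot m \<theta> 0 0 0"
          unfolding rot_cross rot_add by (rule rot_cong; insert profile_identities(1)[of t]; ((simp add: algebra_simps power2_eq_square; fail) | algebra))
        show "rot m \<theta> ((real m)\<^sup>2 * S t * ((T t)\<^sup>2 - (S t)\<^sup>2)) 0 (- 2 * (real m)\<^sup>2 * (S t)\<^sup>2 * T t)
          + rot m \<theta> (real m * - (real m * S t)) (real m * (real m * - 0)) 0 = k *\<^sub>R frame_W t \<theta>"
          unfolding rot_scaleR rot_add by (rule rot_cong; insert profile_identities(1)[of t] k_def; ((simp add: algebra_simps power2_eq_square; fail) | algebra))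
      qed (simp_all add: rot_zero k_def)
    qed
  qed
qed

text \<open>Since \<open>N\<^sub>1\<close> and \<open>N\<^sub>2\<close> are harmonic, their undifferentiated contribution vanishes, and the identity
  \<open>W\<^sub>\<theta> \<times> N\<^sub>1 + N\<^sub>1\<^sub>t = m T N\<^sub>1\<close> with its three companions turns the right-hand side into
  \<open>2 m T\<close> times derivatives along \<open>N\<^sub>1\<close> and \<open>N\<^sub>2\<close>. The derivatives of \<open>N\<^sub>1\<close> and \<open>N\<^sub>2\<close> drop out of the
  combination \<open>f\<^sub>t + \<i> f\<^sub>\<theta>\<close> by conjugacy.\<close>

lemma tangential_equation:
  obtains ft fs ftt fss where
    "cylinder_C2 (\<lambda>t \<theta>. of_real (cyl \<phi> t \<theta> \<bullet> frame_N1 t \<theta>) + \<i> * of_real (cyl \<phi> t \<theta> \<bullet> frame_N2 t \<theta>)) ft fs ftt fss"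
    "\<And>t \<theta>. ftt t \<theta> + fss t \<theta> = of_real (2 * real m * T t) * (ft t \<theta> + \<i> * fs t \<theta>)"
proof (rule that[OF cylinder_C2_Complex[OF cylinder_C2_bilinear[OF bounded_bilinear_inner cylinder_C2_cyl cylinder_C2_frame_N1]
    cylinder_C2_bilinear[OF bounded_bilinear_inner cylinder_C2_cyl cylinder_C2_frame_N2]]])
  fix t \<theta>
  have TC: "T t * C t = Sh t" "Sh t * S t = T t" using profile_identities(3,4)[of t] by (simp_all add: mult_ac)
  have "T t * Sh t = S t * (Sh t)\<^sup>2" by (simp add: profile_identities(3)[of t] power2_eq_square)
  also have "(Sh t)\<^sup>2 = (C t)\<^sup>2 - 1" using profile_identities(5)[of t] by simp
  also have "S t * ((C t)\<^sup>2 - 1) = (C t * S t) * C t - S t" by (simp add: algebra_simps power2_eq_square)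
  finally have TS: "T t * Sh t = C t - S t" by (simp add: profile_identities(4))
  \<comment> \<open>The profile identities multiplied by \<open>m\<close>, the form in which they enter the coefficients below.\<close>
  note alg = TC[THEN arg_cong[of _ _ "\<lambda>x. real m * x"]] TS[THEN arg_cong[of _ _ "\<lambda>x. real m * x"]] profile_identities(4)[of t]
  have 1: "((cyl \<phi> t \<theta> \<bullet> rot m \<theta> (- (real m * (real m * Sh t))) 0 0 + cyl_t \<phi> t \<theta> \<bullet> rot m \<theta> (- (real m * C t)) 0 0)
      + (cyl_t \<phi> t \<theta> \<bullet> rot m \<theta> (- (real m * C t)) 0 0 + cyl_tt \<phi> t \<theta> \<bullet> frame_N1 t \<theta>))
      + ((cyl \<phi> t \<theta> \<bullet> rot m \<theta> (real m * - (real m * - Sh t)) (real m * (real m * - 0)) 0 + cyl_s \<phi> t \<theta> \<bullet> rot m \<theta> (real m * - 0) (real m * - Sh t) 0)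
      + (cyl_s \<phi> t \<theta> \<bullet> rot m \<theta> (real m * - 0) (real m * - Sh t) 0 + cyl_ss \<phi> t \<theta> \<bullet> frame_N1 t \<theta>))
    = cyl \<phi> t \<theta> \<bullet> rot m \<theta> 0 0 0 + 2 * (cyl_t \<phi> t \<theta> \<bullet> ((real m * T t) *\<^sub>R frame_N1 t \<theta>))
      + 2 * (cyl_s \<phi> t \<theta> \<bullet> ((- (real m * T t)) *\<^sub>R frame_N2 t \<theta>))"
  proof (rule projected_equation[OF cyl_equation_W])
    show "cross3 (frame_N1 t \<theta>) (rot m \<theta> (- (real m * S t * T t)) 0 (real m * (S t)\<^sup>2)) + rot m \<theta> (real m * - 0) (real m * - Sh t) 0 = (- (real m * T t)) *\<^sub>R frame_N2 t \<theta>"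
      unfolding rot_cross rot_add rot_scaleR by (rule rot_cong; insert alg; ((simp add: algebra_simps power2_eq_square; fail) | algebra))
    show "cross3 (rot m \<theta> 0 (real m * S t) 0) (frame_N1 t \<theta>) + rot m \<theta> (- (real m * C t)) 0 0 = (real m * T t) *\<^sub>R frame_N1 t \<theta>"
      unfolding rot_cross rot_add rot_scaleR by (rule rot_cong; insert alg; ((simp add: algebra_simps power2_eq_square; fail) | algebra))
    show "rot m \<theta> (- (real m * (real m * Sh t))) 0 0 + rot m \<theta> (real m * - (real m * - Sh t)) (real m * (real m * - 0)) 0 = rot m \<theta> 0 0 0"
      unfolding rot_add by (rule rot_cong; insert alg; ((simp add: algebra_simps power2_eq_square; fail) | algebra))
  qed
  have 2: "((cyl \<phi> t \<theta> \<bullet> rot m \<theta> 0 (real m * (real m * C t)) 0 + cyl_t \<phi> t \<theta> \<bullet> rot m \<theta> 0 (real m * Sh t) 0)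
      + (cyl_t \<phi> t \<theta> \<bullet> rot m \<theta> 0 (real m * Sh t) 0 + cyl_tt \<phi> t \<theta> \<bullet> frame_N2 t \<theta>))
      + ((cyl \<phi> t \<theta> \<bullet> rot m \<theta> (real m * - (real m * 0)) (real m * (real m * - C t)) 0 + cyl_s \<phi> t \<theta> \<bullet> rot m \<theta> (real m * - C t) (real m * 0) 0)
      + (cyl_s \<phi> t \<theta> \<bullet> rot m \<theta> (real m * - C t) (real m * 0) 0 + cyl_ss \<phi> t \<theta> \<bullet> frame_N2 t \<theta>))
    = cyl \<phi> t \<theta> \<bullet> rot m \<theta> 0 0 0 + 2 * (cyl_t \<phi> t \<theta> \<bullet> ((real m * T t) *\<^sub>R frame_N2 t \<theta>))
      + 2 * (cyl_s \<phi> t \<theta> \<bullet> ((real m * T t) *\<^sub>R frame_N1 t \<theta>))"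
  proof (rule projected_equation[OF cyl_equation_W])
    show "cross3 (frame_N2 t \<theta>) (rot m \<theta> (- (real m * S t * T t)) 0 (real m * (S t)\<^sup>2)) + rot m \<theta> (real m * - C t) (real m * 0) 0 = (real m * T t) *\<^sub>R frame_N1 t \<theta>"
      unfolding rot_cross rot_add rot_scaleR by (rule rot_cong; insert alg; ((simp add: algebra_simps power2_eq_square; fail) | algebra))
    show "cross3 (rot m \<theta> 0 (real m * S t) 0) (frame_N2 t \<theta>) + rot m \<theta> 0 (real m * Sh t) 0 = (real m * T t) *\<^sub>R frame_N2 t \<theta>"
      unfolding rot_cross rot_add rot_scaleR by (rule rot_cong; insert alg; ((simp add: algebra_simps power2_eq_square; fail) | algebra))
    show "rot m \<theta> 0 (real m * (real m * C t)) 0 + rot m \<theta> (real m * - (real m * 0)) (real m * (real m * - C t)) 0 = rot m \<theta> 0 0 0"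
      unfolding rot_add by (rule rot_cong; insert alg; ((simp add: algebra_simps power2_eq_square; fail) | algebra))
  qed
  have N: "rot m \<theta> (real m * - C t) (real m * 0) 0 = rot m \<theta> (- (real m * C t)) 0 0"
    "rot m \<theta> (real m * - 0) (real m * - Sh t) 0 = - rot m \<theta> 0 (real m * Sh t) 0"
    by (simp_all add: rot_def vec_eq_iff forall_3)
  show "complex_of_real
         (cyl \<phi> t \<theta> \<bullet> rot m \<theta> (- (real m * (real m * Sh t))) 0 0 + cyl_t \<phi> t \<theta> \<bullet> rot m \<theta> (- (real m * C t)) 0 0 +
          (cyl_t \<phi> t \<theta> \<bullet> rot m \<theta> (- (real m * C t)) 0 0 + cyl_tt \<phi> t \<theta> \<bullet> frame_N1 t \<theta>)) +
        \<i> * complex_of_real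
          (cyl \<phi> t \<theta> \<bullet> rot m \<theta> 0 (real m * (real m * C t)) 0 + cyl_t \<phi> t \<theta> \<bullet> rot m \<theta> 0 (real m * Sh t) 0 +
           (cyl_t \<phi> t \<theta> \<bullet> rot m \<theta> 0 (real m * Sh t) 0 + cyl_tt \<phi> t \<theta> \<bullet> frame_N2 t \<theta>)) +
        (complex_of_real
          (cyl \<phi> t \<theta> \<bullet> rot m \<theta> (real m * - (real m * - Sh t)) (real m * (real m * - 0)) 0 + cyl_s \<phi> t \<theta> \<bullet> rot m \<theta> (real m * - 0) (real m * - Sh t) 0 +
           (cyl_s \<phi> t \<theta> \<bullet> rot m \<theta> (real m * - 0) (real m * - Sh t) 0 + cyl_ss \<phi> t \<theta> \<bullet> frame_N1 t \<theta>)) +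
         \<i> * complex_of_real
           (cyl \<phi> t \<theta> \<bullet> rot m \<theta> (real m * - (real m * 0)) (real m * (real m * - C t)) 0 + cyl_s \<phi> t \<theta> \<bullet> rot m \<theta> (real m * - C t) (real m * 0) 0 +
            (cyl_s \<phi> t \<theta> \<bullet> rot m \<theta> (real m * - C t) (real m * 0) 0 + cyl_ss \<phi> t \<theta> \<bullet> frame_N2 t \<theta>)))
     = of_real (2 * real m * T t) *
        (complex_of_real (cyl \<phi> t \<theta> \<bullet> rot m \<theta> (- (real m * C t)) 0 0 + cyl_t \<phi> t \<theta> \<bullet> frame_N1 t \<theta>) +
         \<i> * complex_of_real (cyl \<phi> t \<theta> \<bullet> rot m \<theta> 0 (real m * Sh t) 0 + cyl_t \<phi> t \<theta> \<bullet> frame_N2 t \<theta>) +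
         \<i> * (complex_of_real (cyl \<phi> t \<theta> \<bullet> rot m \<theta> (real m * - 0) (real m * - Sh t) 0 + cyl_s \<phi> t \<theta> \<bullet> frame_N1 t \<theta>) +
           \<i> * complex_of_real (cyl \<phi> t \<theta> \<bullet> rot m \<theta> (real m * - C t) (real m * 0) 0 + cyl_s \<phi> t \<theta> \<bullet> frame_N2 t \<theta>)))"
    (is "of_real ?a1 + \<i> * of_real ?b1 + (of_real ?a2 + \<i> * of_real ?b2) = _")
  proof -
    have "of_real ?a1 + \<i> * of_real ?b1 + (of_real ?a2 + \<i> * of_real ?b2) = complex_of_real (?a1 + ?a2) + \<i> * of_real (?b1 + ?b2)"
      by (simp only: of_real_add distrib_left add_ac)
    then show ?thesis unfolding 1 2 unfolding N rot_zero
      by (simp add: complex_eq_iff algebra_simps)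
  qed
qed

section \<open>Classification of the bounded solutions\<close>

text \<open>Mode by mode, real and imaginary part of the coefficients are governed by
  \<open>normal_mode_solution\<close>. The surviving profiles are \<open>- m T\<close> for \<open>k = 0\<close> and
  \<open>exp (m t) (m - m T) = m S\<close> for \<open>k = \<plusminus>m\<close>.\<close>

lemma normal_component:
  "\<exists>a b c. \<forall>t \<theta>. cyl \<phi> t \<theta> \<bullet> frame_W t \<theta>
     = a * T t + (b * cos (real m * \<theta>) + c * sin (real m * \<theta>)) * S t"
proof -
  obtain gt gs gtt gss M where
    g: "cylinder_C2 (\<lambda>t \<theta>. cyl \<phi> t \<theta> \<bullet> frame_W t \<theta>) gt gs gtt gss"
    and eq: "\<And>t \<theta>. gtt t \<theta> + gss t \<theta> = - (2 * (real m)\<^sup>2 * (S t)\<^sup>2) * (cyl \<phi> t \<theta> \<bullet> frame_W t \<theta>)"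
    and M: "\<And>t \<theta>. t \<le> 0 \<Longrightarrow> \<bar>gt t \<theta>\<bar> \<le> M * exp t"
    by (rule normal_equation) (rule that)
  define u where "u = (\<lambda>t \<theta>. complex_of_real (cyl \<phi> t \<theta> \<bullet> frame_W t \<theta>))"
  have u: "cylinder_C2 u (\<lambda>t \<theta>. of_real (gt t \<theta>)) (\<lambda>t \<theta>. of_real (gs t \<theta>)) (\<lambda>t \<theta>. of_real (gtt t \<theta>)) (\<lambda>t \<theta>. of_real (gss t \<theta>))"
    using cylinder_C2_Complex[OF g cylinder_C2_zero] by (simp add: u_def)
  note D = cylinder_C2D[OF u]
  have ub: "norm (u t \<theta>) \<le> B" for t \<theta>
  proof -
    have "norm (frame_W t \<theta>) = 1" by (simp add: norm_rot profile_identities(1))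
    then have "\<bar>cyl \<phi> t \<theta> \<bullet> frame_W t \<theta>\<bar> \<le> norm (cyl \<phi> t \<theta>) * 1"
      by (metis Cauchy_Schwarz_ineq2)
    with bdd show ?thesis by (simp add: u_def cyl_def order_trans)
  qed
  define y where "y = (\<lambda>k t. fourier_coeff k (u t))"
  define y1 where "y1 = (\<lambda>k t. fourier_coeff k (\<lambda>\<theta>. of_real (gt t \<theta>)))"
  have y: "(y k has_vector_derivative y1 k t) (at t)" for k t
    using fourier_coeff_cylinder(1)[OF u] by (simp add: y_def y1_def)
  have y1: "(y1 k has_vector_derivative ((real_of_int \<bar>k\<bar>)\<^sup>2 - 2 * (real m)\<^sup>2 / (cosh (real m * t))\<^sup>2) *\<^sub>R y k t) (at t)" for k t
  proof -
    have "fourier_coeff k (\<lambda>\<theta>. of_real (gtt t \<theta>)) + fourier_coeff k (\<lambda>\<theta>. of_real (gss t \<theta>))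
        = fourier_coeff k (\<lambda>\<theta>. of_real (gtt t \<theta>) + of_real (gss t \<theta>))"
      using fourier_coeff_add[OF continuous_on_slice[OF D(10)] continuous_on_slice[OF D(11)]] by simp
    also have "\<dots> = fourier_coeff k (\<lambda>\<theta>. of_real (- (2 * (real m)\<^sup>2 * (S t)\<^sup>2)) * u t \<theta>)"
      unfolding of_real_add[symmetric] eq by (simp add: u_def)
    also have "\<dots> = of_real (- (2 * (real m)\<^sup>2 * (S t)\<^sup>2)) * y k t"
      unfolding fourier_coeff_mult y_def ..
    finally have "fourier_coeff k (\<lambda>\<theta>. of_real (gtt t \<theta>)) = ((real_of_int \<bar>k\<bar>)\<^sup>2 - 2 * (real m)\<^sup>2 / (cosh (real m * t))\<^sup>2) *\<^sub>R y k t"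
      using fourier_coeff_cylinder(4)[OF u, of k t]
      by (simp add: y_def S_def scaleR_conv_of_real power_divide algebra_simps flip: of_int_power)
    with fourier_coeff_cylinder(2)[OF u, of k t] show ?thesis by (simp add: y1_def)
  qed
  have y_le: "norm (y k t) \<le> B" for k t
    unfolding y_def by (rule norm_fourier_coeff_le[OF continuous_on_slice[OF D(7)] ub])
  have y1_lim: "((\<lambda>t. y1 k t) \<longlongrightarrow> 0) at_bot" for k
  proof (rule Lim_null_comparison)
    show "\<forall>\<^sub>F t in at_bot. norm (y1 k t) \<le> M * exp t"
      using eventually_le_at_bot[of 0]
      by eventually_elim (auto simp: y1_def intro!: norm_fourier_coeff_le continuous_on_slice[OF D(8)] M)
    show "((\<lambda>t. M * exp t) \<longlongrightarrow> 0) at_bot"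
      by (intro tendsto_mult_right_zero exp_at_bot)
  qed
  have "\<exists>c. (\<forall>t. y k t = c * of_real (exp (real_of_int \<bar>k\<bar> * t) * (real_of_int \<bar>k\<bar> - real m * T t)))
      \<and> (c = 0 \<or> real_of_int \<bar>k\<bar> = 0 \<or> real_of_int \<bar>k\<bar> = real m)" for k
  proof -
    have mpos: "real m > 0" using m by simp
    have Reb: "\<bar>Re (y k t)\<bar> \<le> B" and Imb: "\<bar>Im (y k t)\<bar> \<le> B" for t
      using abs_Re_le_cmod[of "y k t"] abs_Im_le_cmod[of "y k t"] y_le[of k t] by linarith+
    have lims: "((\<lambda>t. Re (y1 k t)) \<longlongrightarrow> 0) at_bot" "((\<lambda>t. Im (y1 k t)) \<longlongrightarrow> 0) at_bot"
      using tendsto_Re[OF y1_lim[of k]] tendsto_Im[OF y1_lim[of k]] by simp_all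
    have "\<exists>C. (\<forall>t. Re (y k t) = C * (exp (real_of_int \<bar>k\<bar> * t) * (real_of_int \<bar>k\<bar> - real m * tanh (real m * t)))) \<and> (C = 0 \<or> real_of_int \<bar>k\<bar> = 0 \<or> real_of_int \<bar>k\<bar> = real m)"
      using has_real_derivative_Re_Im(1)[OF y] has_real_derivative_Re_Im(1)[OF y1] Reb lims(1) mpos
      by (intro normal_mode_solution) auto
    moreover have "\<exists>C. (\<forall>t. Im (y k t) = C * (exp (real_of_int \<bar>k\<bar> * t) * (real_of_int \<bar>k\<bar> - real m * tanh (real m * t)))) \<and> (C = 0 \<or> real_of_int \<bar>k\<bar> = 0 \<or> real_of_int \<bar>k\<bar> = real m)"
      using has_real_derivative_Re_Im(2)[OF y] has_real_derivative_Re_Im(2)[OF y1] Imb lims(2) mpos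
      by (intro normal_mode_solution) auto
    ultimately obtain C1 C2 where
      "\<And>t. Re (y k t) = C1 * (exp (real_of_int \<bar>k\<bar> * t) * (real_of_int \<bar>k\<bar> - real m * T t))"
      "\<And>t. Im (y k t) = C2 * (exp (real_of_int \<bar>k\<bar> * t) * (real_of_int \<bar>k\<bar> - real m * T t))"
      "C1 = 0 \<or> real_of_int \<bar>k\<bar> = 0 \<or> real_of_int \<bar>k\<bar> = real m" "C2 = 0 \<or> real_of_int \<bar>k\<bar> = 0 \<or> real_of_int \<bar>k\<bar> = real m"
      unfolding T_def by blast
    then show ?thesis
      by (intro exI[of _ "Complex C1 C2"]) (auto simp: complex_eq_iff)
  qed
  then obtain c where c: "\<And>k t. y k t = c k * of_real (exp (real_of_int \<bar>k\<bar> * t) * (real_of_int \<bar>k\<bar> - real m * T t))"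
    and c0: "\<And>k. c k = 0 \<or> real_of_int \<bar>k\<bar> = 0 \<or> real_of_int \<bar>k\<bar> = real m"
    by metis
  have e: "exp (real m * t) * (real m - real m * T t) = real m * S t" for t
    using exp_times_one_minus_tanh[of "real m * t", THEN arg_cong[of _ _ "\<lambda>x. real m * x"]]
    by (simp add: S_def T_def algebra_simps)
  have "u t \<theta> = (\<Sum>k\<in>{0, int m, - int m}. y k t * cis (of_int k * \<theta>))" for t \<theta>
    unfolding y_def
  proof (rule finite_fourier_expansion[OF continuous_on_slice[OF D(7)] D(5)])
    show "fourier_coeff k (u t) = 0" if "k \<notin> {0, int m, - int m}" for k
    proof -
      have "c k = 0" using c0[of k] that by (auto simp: abs_if split: if_splits)
      then show ?thesis using c[of k t] by (simp add: y_def)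
    qed
  qed simp
  also have "(\<Sum>k\<in>{0, int m, - int m}. y k t * cis (of_int k * \<theta>))
      = y 0 t + y (int m) t * cis (real m * \<theta>) + y (- int m) t * cis (- (real m * \<theta>))" for t \<theta>
    using m by simp
  finally have u_eq: "u t \<theta> = c 0 * of_real (- real m * T t) + c (int m) * of_real (real m * S t) * cis (real m * \<theta>)
      + c (- int m) * of_real (real m * S t) * cis (- (real m * \<theta>))" for t \<theta>
    by (simp add: c e)
  have "Re (u t \<theta>) = (- real m * Re (c 0)) * T t + ((real m * (Re (c (int m)) + Re (c (- int m)))) * cos (real m * \<theta>)
     + (real m * (Im (c (- int m)) - Im (c (int m)))) * sin (real m * \<theta>)) * S t" for t \<theta>
    unfolding u_eq by (simp add: algebra_simps)
  moreover have "Re (u t \<theta>) = cyl \<phi> t \<theta> \<bullet> frame_W t \<theta>" for t \<theta> by (simp add: u_def)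
  ultimately show ?thesis by metis
qed

text \<open>The vectors \<open>N\<^sub>1\<close> and \<open>N\<^sub>2\<close> have length \<open>cosh (m t)\<close>, so boundedness of \<open>\<phi>\<close> is exactly the growth
  condition under which \<open>tangential_mode_solution\<close> applies.\<close>

lemma tangential_components:
  "\<exists>c. \<forall>t \<theta>. of_real (cyl \<phi> t \<theta> \<bullet> frame_N1 t \<theta>) + \<i> * of_real (cyl \<phi> t \<theta> \<bullet> frame_N2 t \<theta>)
     = (\<Sum>k\<in>{- int m..int m}. c k * of_real (exp (of_int k * t)) * cis (of_int k * \<theta>))"
proof -
  define u where "u = (\<lambda>t \<theta>. of_real (cyl \<phi> t \<theta> \<bullet> frame_N1 t \<theta>) + \<i> * of_real (cyl \<phi> t \<theta> \<bullet> frame_N2 t \<theta>))"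
  obtain ft fs ftt fss where
    u0: "cylinder_C2 (\<lambda>t \<theta>. of_real (cyl \<phi> t \<theta> \<bullet> frame_N1 t \<theta>) + \<i> * of_real (cyl \<phi> t \<theta> \<bullet> frame_N2 t \<theta>)) ft fs ftt fss"
    and eq: "\<And>t \<theta>. ftt t \<theta> + fss t \<theta> = of_real (2 * real m * T t) * (ft t \<theta> + \<i> * fs t \<theta>)"
  proof (rule tangential_equation)
    fix ft fs ftt fss
    assume "cylinder_C2 (\<lambda>t \<theta>. of_real (cyl \<phi> t \<theta> \<bullet> frame_N1 t \<theta>) + \<i> * of_real (cyl \<phi> t \<theta> \<bullet> frame_N2 t \<theta>)) ft fs ftt fss"
      and "\<And>t \<theta>. ftt t \<theta> + fss t \<theta> = of_real (2 * real m * T t) * (ft t \<theta> + \<i> * fs t \<theta>)"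
    then show thesis by (rule that)
  qed
  have u: "cylinder_C2 u ft fs ftt fss" using u0 unfolding u_def .
  note D = cylinder_C2D[OF u]
  have ub: "norm (u t \<theta>) \<le> (2 * B) * cosh (real m * t)" for t \<theta>
  proof -
    have "norm (frame_N1 t \<theta>) = C t"
    proof -
      have "(Sh t)\<^sup>2 + 1 = (C t)\<^sup>2" using profile_identities(5)[of t] by simp
      with profile_identities(6)[of t] show ?thesis by (simp add: norm_rot)
    qed
    moreover have "norm (frame_N2 t \<theta>) = C t" using profile_identities(6)[of t] by (simp add: norm_rot)
    ultimately have "\<bar>cyl \<phi> t \<theta> \<bullet> frame_N1 t \<theta>\<bar> \<le> norm (cyl \<phi> t \<theta>) * C t"
      "\<bar>cyl \<phi> t \<theta> \<bullet> frame_N2 t \<theta>\<bar> \<le> norm (cyl \<phi> t \<theta>) * C t"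
      by (metis Cauchy_Schwarz_ineq2)+
    moreover have "norm (cyl \<phi> t \<theta>) * C t \<le> B * C t"
      using bdd profile_identities(6)[of t] by (intro mult_right_mono) (auto simp: cyl_def)
    moreover have "norm (u t \<theta>) \<le> \<bar>cyl \<phi> t \<theta> \<bullet> frame_N1 t \<theta>\<bar> + \<bar>cyl \<phi> t \<theta> \<bullet> frame_N2 t \<theta>\<bar>"
      unfolding u_def by (rule order_trans[OF norm_triangle_ineq]) (simp add: norm_mult)
    ultimately have "norm (u t \<theta>) \<le> 2 * (B * C t)" by linarith
    then show ?thesis by (simp add: C_def)
  qed
  have "\<exists>c. (\<forall>t. fourier_coeff k (u t) = c * of_real (exp (of_int k * t))) \<and> (c = 0 \<or> \<bar>real_of_int k\<bar> \<le> real m)" for k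
  proof (rule tangential_mode_solution[OF fourier_coeff_cylinder(1)[OF u] fourier_coeff_cylinder(2)[OF u]])
    show "norm (fourier_coeff k (u t)) \<le> (2 * B) * cosh (real m * t)" for t
      by (rule norm_fourier_coeff_le[OF continuous_on_slice[OF D(7)] ub])
    show "real m > 0" using m by simp
    show "fourier_coeff k (ftt t) - (of_int k)\<^sup>2 *\<^sub>R fourier_coeff k (u t)
        = (2 * real m * tanh (real m * t)) *\<^sub>R (fourier_coeff k (ft t) - of_int k *\<^sub>R fourier_coeff k (u t))" for t
    proof -
      have "fourier_coeff k (ftt t) - (of_int k)\<^sup>2 *\<^sub>R fourier_coeff k (u t) = fourier_coeff k (ftt t) + fourier_coeff k (fss t)"
        by (simp add: fourier_coeff_cylinder(4)[OF u] scaleR_conv_of_real)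
      also have "\<dots> = fourier_coeff k (\<lambda>\<theta>. ftt t \<theta> + fss t \<theta>)"
        by (rule fourier_coeff_add[OF continuous_on_slice[OF D(10)] continuous_on_slice[OF D(11)], symmetric])
      also have "\<dots> = fourier_coeff k (\<lambda>\<theta>. of_real (2 * real m * T t) * (ft t \<theta> + \<i> * fs t \<theta>))"
        by (simp only: eq)
      also have "\<dots> = of_real (2 * real m * T t) * (fourier_coeff k (ft t) + \<i> * fourier_coeff k (fs t))"
      proof -
        have "continuous_on {0..2 * pi} (\<lambda>\<theta>. \<i> * fs t \<theta>)"
          by (intro continuous_on_mult continuous_on_const continuous_on_slice[OF D(9)])
        from fourier_coeff_add[OF continuous_on_slice[OF D(8)] this] show ?thesis
          by (simp only: fourier_coeff_mult)
      qed
      finally show ?thesis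
        by (simp add: fourier_coeff_cylinder(3)[OF u] T_def scaleR_conv_of_real flip: mult.assoc)
    qed
  qed
  then obtain c where c: "\<And>k t. fourier_coeff k (u t) = c k * of_real (exp (of_int k * t))"
    and c0: "\<And>k. c k = 0 \<or> \<bar>real_of_int k\<bar> \<le> real m" by metis
  have "u t \<theta> = (\<Sum>k\<in>{- int m..int m}. fourier_coeff k (u t) * cis (of_int k * \<theta>))" for t \<theta>
  proof (rule finite_fourier_expansion[OF continuous_on_slice[OF D(7)] D(5)])
    show "fourier_coeff k (u t) = 0" if "k \<notin> {- int m..int m}" for k
    proof -
      have "c k = 0" using c0[of k] that by auto
      then show ?thesis using c[of k t] by simp
    qed
  qed simp
  then show ?thesis unfolding c by (auto simp: u_def)
qed

lemma solution_in_frame: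
  "\<phi> (polar (exp t) \<theta>) = (cyl \<phi> t \<theta> \<bullet> frame_W t \<theta>) *\<^sub>R frame_W t \<theta>
     - ((cyl \<phi> t \<theta> \<bullet> frame_N1 t \<theta>) * S t) *\<^sub>R rot m \<theta> (T t) 0 (- S t)
     + ((cyl \<phi> t \<theta> \<bullet> frame_N2 t \<theta>) * S t) *\<^sub>R rot m \<theta> 0 1 0"
proof -
  have "(- S t) *\<^sub>R frame_N1 t \<theta> = rot m \<theta> (T t) 0 (- S t)" "S t *\<^sub>R frame_N2 t \<theta> = rot m \<theta> 0 1 0"
    unfolding rot_scaleR using profile_identities(3,4)[of t] by (simp_all add: mult.commute)
  then have "cyl \<phi> t \<theta> \<bullet> rot m \<theta> (T t) 0 (- S t) = - ((cyl \<phi> t \<theta> \<bullet> frame_N1 t \<theta>) * S t)"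
    "cyl \<phi> t \<theta> \<bullet> rot m \<theta> 0 1 0 = (cyl \<phi> t \<theta> \<bullet> frame_N2 t \<theta>) * S t"
    by (metis inner_scaleR_right mult.commute mult_minus_left)+
  with rot_expansion[OF profile_identities(1)[of t], of "cyl \<phi> t \<theta>" m \<theta>] show ?thesis
    by (simp add: cyl_def)
qed

text \<open>Translation of the two components into the listed functions: \<open>S\<close> contributes
  \<open>2 r ^ m / (1 + r ^ (2 m))\<close>, and the exponent \<open>k\<close> of \<open>exp (k t) = r ^ k\<close> is split by sign, the modes \<open>- k\<close> with
  \<open>0 \<le> k \<le> m\<close> giving the powers \<open>r ^ (m - k)\<close> and the modes \<open>1 \<le> l \<le> m\<close> the powers \<open>r ^ (m + l)\<close>. The real and imaginary parts of
  a coefficient are the real coefficients up to a factor \<open>\<plusminus>2\<close>.\<close>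

lemma bounded_solution_expansion:
  "\<exists>a b c \<alpha> \<beta> \<gamma> \<delta>. \<forall>t \<theta>. \<phi> (polar (exp t) \<theta>) = kernel_combination m a b c \<alpha> \<beta> \<gamma> \<delta> (exp t) \<theta>"
proof -
  obtain a b c where normal: "\<And>t \<theta>. cyl \<phi> t \<theta> \<bullet> frame_W t \<theta>
     = a * T t + (b * cos (real m * \<theta>) + c * sin (real m * \<theta>)) * S t"
    using normal_component by blast
  obtain d where tangential: "\<And>t \<theta>. of_real (cyl \<phi> t \<theta> \<bullet> frame_N1 t \<theta>) + \<i> * of_real (cyl \<phi> t \<theta> \<bullet> frame_N2 t \<theta>)
     = (\<Sum>k\<in>{- int m..int m}. d k * of_real (exp (of_int k * t)) * cis (of_int k * \<theta>))"
    using tangential_components by blast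
  define z where "z = (\<lambda>t \<theta> k. d k * of_real (exp (of_int k * t)) * cis (of_int k * \<theta>))"
  define \<alpha> \<beta> \<gamma> \<delta> where "\<alpha> = (\<lambda>k. - 2 * Re (d (- int k)))" and "\<beta> = (\<lambda>k. - 2 * Im (d (- int k)))"
    and "\<gamma> = (\<lambda>l. - 2 * Re (d (int l)))" and "\<delta> = (\<lambda>l. 2 * Im (d (int l)))"
  have "\<phi> (polar (exp t) \<theta>) = kernel_combination m a (2 * b) (2 * c) \<alpha> \<beta> \<gamma> \<delta> (exp t) \<theta>" for t \<theta>
  proof -
    let ?r = "exp t" and ?W = "W_polar m (exp t) \<theta>" and ?E1 = "E1 m (exp t) \<theta>" and ?E2 = "E2 m (exp t) \<theta>"
    have Re: "cyl \<phi> t \<theta> \<bullet> frame_N1 t \<theta> = (\<Sum>k\<in>{- int m..int m}. Re (z t \<theta> k))"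
      and Im: "cyl \<phi> t \<theta> \<bullet> frame_N2 t \<theta> = (\<Sum>k\<in>{- int m..int m}. Im (z t \<theta> k))"
      using tangential[of t \<theta>, THEN arg_cong[of _ _ Re]] tangential[of t \<theta>, THEN arg_cong[of _ _ Im]]
      by (simp_all add: z_def)
    define V where "V = (\<lambda>k. (- Re (z t \<theta> k) * S t) *\<^sub>R ?E1 + (Im (z t \<theta> k) * S t) *\<^sub>R ?E2)"
    have "\<phi> (polar (exp t) \<theta>) = (a * T t + (b * cos (real m * \<theta>) + c * sin (real m * \<theta>)) * S t) *\<^sub>R ?W
        + (\<Sum>k\<in>{- int m..int m}. V k)"
      unfolding solution_in_frame normal frame_radial Re Im V_def
      by (simp add: sum.distrib sum_subtractf sum_distrib_right scaleR_sum_left sum_negf)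
    also have "(\<Sum>k\<in>{- int m..int m}. V k) = (\<Sum>k=0..m. V (- int k)) + (\<Sum>l=1..m. V (int l))"
      by (rule sum_symmetric_int_interval)
    also have "(\<Sum>k=0..m. V (- int k)) = (\<Sum>k=0..m.
                \<alpha> k *\<^sub>R ((?r ^ (m - k) / (1 + ?r ^ (2 * m))) *\<^sub>R
                  (cos (real k * \<theta>) *\<^sub>R ?E1 + sin (real k * \<theta>) *\<^sub>R ?E2))
              + \<beta> k *\<^sub>R ((?r ^ (m - k) / (1 + ?r ^ (2 * m))) *\<^sub>R
                  (sin (real k * \<theta>) *\<^sub>R ?E1 - cos (real k * \<theta>) *\<^sub>R ?E2)))"
    proof (rule sum.cong[OF refl])
      fix k assume k: "k \<in> {0..m}"
      define \<rho> where "\<rho> = ?r ^ (m - k) / (1 + ?r ^ (2 * m))"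
      have p: "exp (- (real k * t)) * ?r ^ m = ?r ^ (m - k)"
        using k by (simp add: algebra_simps of_nat_diff flip: exp_of_nat_mult exp_add)
      have e: "2 * \<rho> = exp (- (real k * t)) * S t"
        unfolding S_T_radial \<rho>_def p[symmetric] by simp
      have V: "- Re (z t \<theta> (- int k)) * S t = - (Re (d (- int k)) * cos (real k * \<theta>) + Im (d (- int k)) * sin (real k * \<theta>)) * (2 * \<rho>)"
        "Im (z t \<theta> (- int k)) * S t = (Im (d (- int k)) * cos (real k * \<theta>) - Re (d (- int k)) * sin (real k * \<theta>)) * (2 * \<rho>)"
        unfolding e by (simp_all add: z_def algebra_simps)
      show "V (- int k) = \<alpha> k *\<^sub>R (\<rho> *\<^sub>R (cos (real k * \<theta>) *\<^sub>R ?E1 + sin (real k * \<theta>) *\<^sub>R ?E2))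
              + \<beta> k *\<^sub>R (\<rho> *\<^sub>R (sin (real k * \<theta>) *\<^sub>R ?E1 - cos (real k * \<theta>) *\<^sub>R ?E2))"
        unfolding V_def V \<alpha>_def \<beta>_def by (simp add: algebra_simps)
    qed
    also have "(\<Sum>l=1..m. V (int l)) = (\<Sum>l=1..m.
                \<gamma> l *\<^sub>R ((?r ^ (m + l) / (1 + ?r ^ (2 * m))) *\<^sub>R
                  (cos (real l * \<theta>) *\<^sub>R ?E1 - sin (real l * \<theta>) *\<^sub>R ?E2))
              + \<delta> l *\<^sub>R ((?r ^ (m + l) / (1 + ?r ^ (2 * m))) *\<^sub>R
                  (sin (real l * \<theta>) *\<^sub>R ?E1 + cos (real l * \<theta>) *\<^sub>R ?E2)))"
    proof (rule sum.cong[OF refl])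
      fix l
      define \<rho> where "\<rho> = ?r ^ (m + l) / (1 + ?r ^ (2 * m))"
      have p: "exp (real l * t) * ?r ^ m = ?r ^ (m + l)"
        by (simp add: exp_of_nat_mult power_add)
      have e: "2 * \<rho> = exp (real l * t) * S t"
        unfolding S_T_radial \<rho>_def p[symmetric] by simp
      have V: "- Re (z t \<theta> (int l)) * S t = - (Re (d (int l)) * cos (real l * \<theta>) - Im (d (int l)) * sin (real l * \<theta>)) * (2 * \<rho>)"
        "Im (z t \<theta> (int l)) * S t = (Im (d (int l)) * cos (real l * \<theta>) + Re (d (int l)) * sin (real l * \<theta>)) * (2 * \<rho>)"
        unfolding e by (simp_all add: z_def algebra_simps)
      show "V (int l) = \<gamma> l *\<^sub>R (\<rho> *\<^sub>R (cos (real l * \<theta>) *\<^sub>R ?E1 - sin (real l * \<theta>) *\<^sub>R ?E2))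
              + \<delta> l *\<^sub>R (\<rho> *\<^sub>R (sin (real l * \<theta>) *\<^sub>R ?E1 + cos (real l * \<theta>) *\<^sub>R ?E2))"
        unfolding V_def V \<gamma>_def \<delta>_def by (simp add: algebra_simps)
    qed
    also have "(a * T t + (b * cos (real m * \<theta>) + c * sin (real m * \<theta>)) * S t) *\<^sub>R ?W
       = a *\<^sub>R (((?r ^ (2 * m) - 1) / (?r ^ (2 * m) + 1)) *\<^sub>R ?W)
          + (2 * b) *\<^sub>R ((?r ^ m / (1 + ?r ^ (2 * m)) * cos (real m * \<theta>)) *\<^sub>R ?W)
          + (2 * c) *\<^sub>R ((?r ^ m / (1 + ?r ^ (2 * m)) * sin (real m * \<theta>)) *\<^sub>R ?W)"
      unfolding S_T_radial scaleR_scaleR scaleR_add_left[symmetric]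
      by (rule arg_cong[of _ _ "\<lambda>x. x *\<^sub>R ?W"]) (simp add: algebra_simps add_divide_distrib)
    finally show ?thesis unfolding kernel_combination_def by (simp only: add.assoc)
  qed
  then show ?thesis by blast
qed

end

end

theorem theorem1p1:
  fixes m :: nat
  assumes "m \<ge> 1"
  shows "H_system_solution (W m) \<and>
    (\<forall>\<phi> :: real^2 \<Rightarrow> real^3. C2 \<phi> \<longrightarrow>
      (linearized_solution (W m) \<phi> \<longleftrightarrow>
      (\<forall>r>0. \<forall>\<theta>. laplacian \<phi> (polar r \<theta>) =
         (2 / r) *\<^sub>R (cross3 (dr (W m) r \<theta>) (dtheta \<phi> r \<theta>) + cross3 (dr \<phi> r \<theta>) (dtheta (W m) r \<theta>))))) \<and>
    (\<forall>\<phi> :: real^2 \<Rightarrow> real^3. linearized_solution (W m) \<phi> \<and> bounded (range \<phi>) \<longrightarrow>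
      (\<exists>(a::real) (b::real) (c::real) (\<alpha>::nat \<Rightarrow> real) (\<beta>::nat \<Rightarrow> real) (\<gamma>::nat \<Rightarrow> real) (\<delta>::nat \<Rightarrow> real).
        \<forall>r\<ge>0. \<forall>\<theta>. \<phi> (polar r \<theta>) =
            a *\<^sub>R (((r ^ (2 * m) - 1) / (r ^ (2 * m) + 1)) *\<^sub>R W_polar m r \<theta>)
          + b *\<^sub>R ((r ^ m / (1 + r ^ (2 * m)) * cos (real m * \<theta>)) *\<^sub>R W_polar m r \<theta>)
          + c *\<^sub>R ((r ^ m / (1 + r ^ (2 * m)) * sin (real m * \<theta>)) *\<^sub>R W_polar m r \<theta>)
          + (\<Sum>k=0..m.
                \<alpha> k *\<^sub>R ((r ^ (m - k) / (1 + r ^ (2 * m))) *\<^sub>R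
                  (cos (real k * \<theta>) *\<^sub>R E1 m r \<theta> + sin (real k * \<theta>) *\<^sub>R E2 m r \<theta>))
              + \<beta> k *\<^sub>R ((r ^ (m - k) / (1 + r ^ (2 * m))) *\<^sub>R
                  (sin (real k * \<theta>) *\<^sub>R E1 m r \<theta> - cos (real k * \<theta>) *\<^sub>R E2 m r \<theta>)))
          + (\<Sum>l=1..m.
                \<gamma> l *\<^sub>R ((r ^ (m + l) / (1 + r ^ (2 * m))) *\<^sub>R
                  (cos (real l * \<theta>) *\<^sub>R E1 m r \<theta> - sin (real l * \<theta>) *\<^sub>R E2 m r \<theta>))
              + \<delta> l *\<^sub>R ((r ^ (m + l) / (1 + r ^ (2 * m))) *\<^sub>R
                  (sin (real l * \<theta>) *\<^sub>R E1 m r \<theta> + cos (real l * \<theta>) *\<^sub>R E2 m r \<theta>)))))"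
  unfolding kernel_combination_def[symmetric]
proof (intro conjI allI impI)
  interpret bubble m by unfold_locales (rule assms)
  show "H_system_solution (W m)" by (rule H_system_W[OF assms])
  show "linearized_solution (W m) \<phi> \<longleftrightarrow>
      (\<forall>r>0. \<forall>\<theta>. laplacian \<phi> (polar r \<theta>) =
         (2 / r) *\<^sub>R (cross3 (dr (W m) r \<theta>) (dtheta \<phi> r \<theta>) + cross3 (dr \<phi> r \<theta>) (dtheta (W m) r \<theta>)))"
    if "C2 \<phi>" for \<phi>
    by (rule polar_equation_iff[OF W_C2 that])
  fix \<phi> :: "real^2 \<Rightarrow> real^3"
  assume \<phi>: "linearized_solution (W m) \<phi> \<and> bounded (range \<phi>)"
  then obtain B where "\<And>x. norm (\<phi> x) \<le> B" by (auto simp: bounded_iff)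
  with \<phi> obtain a b c \<alpha> \<beta> \<gamma> \<delta> where
    eq: "\<And>t \<theta>. \<phi> (polar (exp t) \<theta>) = kernel_combination m a b c \<alpha> \<beta> \<gamma> \<delta> (exp t) \<theta>"
    using bounded_solution_expansion by blast
  have "\<phi> (polar r \<theta>) = kernel_combination m a b c \<alpha> \<beta> \<gamma> \<delta> r \<theta>" if "r \<ge> 0" for r \<theta>
  proof -
    \<comment> \<open>Every positive radius is some \<open>exp t\<close>; the origin is reached by continuity along the ray.\<close>
    let ?D = "\<lambda>r. \<phi> (polar r \<theta>) - kernel_combination m a b c \<alpha> \<beta> \<gamma> \<delta> r \<theta>"
    have "C2 \<phi>" using \<phi> by (simp add: linearized_solution_def)
    then have "continuous_on UNIV \<phi>" by (rule has_partials_continuous[OF C2D(1)])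
    from continuous_on_polar[OF this continuous_on_id continuous_on_const]
    have "continuous_on UNIV ?D"
      by (intro continuous_on_diff continuous_on_kernel_combination)
    then have "closed {r. ?D r = 0}"
      using continuous_closed_preimage_constant[OF _ closed_UNIV, of ?D 0] by simp
    moreover have "{0<..} \<subseteq> {r. ?D r = 0}"
    proof
      fix s :: real assume "s \<in> {0<..}"
      then show "s \<in> {r. ?D r = 0}" using eq[of "ln s" \<theta>] by simp
    qed
    ultimately have "closure {0<..} \<subseteq> {r. ?D r = 0}" by (rule closure_minimal[rotated])
    then show ?thesis using that by (auto simp: closure_greaterThan)
  qed
  then show "\<exists>a b c \<alpha> \<beta> \<gamma> \<delta>. \<forall>r\<ge>0. \<forall>\<theta>. \<phi> (polar r \<theta>) = kernel_combination m a b c \<alpha> \<beta> \<gamma> \<delta> r \<theta>"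
    by blast
qed

end
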